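(* Let $S$ be a closed symmetric operator in $\mathcal H$ and let $\lambda\in\mathbb C_+$. Then the characteristic function $C^S_\lambda(z)$ of $S$ has the form $$C^{S}_{\lambda}(z)=\frac{z-\lambda}{z-\bar\lambda}\,P_{\mathfrak N_{\bar\lambda}}\Big(I-\frac{z-\lambda}{z-\bar\lambda}\,Y^*_{\lambda}\Big)^{-1}\upharpoonright\mathfrak N_{\lambda}\qquad\text{for all } z\in\mathbb C_+,$$ where $Y_\lambda=(\widetilde S_\lambda-\lambda I)(\widetilde S_\lambda-\bar\lambda I)^{-1}=(S-\lambda I)(S-\bar\lambda I)^{-1}P_{\mathfrak M_{\bar\lambda}}$ is the Cayley transform of the Shtraus extension $\widetilde S_\lambda$. If in addition $S$ is non-densely defined, then $$\lim_{z\to\infty,\ z\in\mathbb C_+}C^S_\lambda(z)f=V_\lambda f\qquad\text{for all } f\in\mathfrak L_\lambda,$$ where the limit is non-tangential to the real axis.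
   Context: $\mathcal H$ is an infinite-dimensional complex separable Hilbert space; $P_{\mathfrak K}$ is the orthogonal projection onto a closed subspace $\mathfrak K$; $\mathbb C_+$ is the open upper half-plane. An operator $S$ is symmetric if $\operatorname{Im}(Sf,f)=0$ for all $f\in\operatorname{dom}S$ (the domain need not be dense). For a closed symmetric $S$ and $\lambda\in\mathbb C\setminus\mathbb R$: $\mathfrak M_\lambda=\operatorname{ran}(S-\lambda I)$, $\mathfrak N_\lambda=\mathcal H\ominus\mathfrak M_{\bar\lambda}$. If $S$ is non-densely defined: $\mathfrak L=\mathcal H\ominus\overline{\operatorname{dom}}\,S$, $\mathfrak L_\lambda=P_{\mathfrak N_\lambda}\mathfrak L$, and $V_\lambda:\mathfrak L_\lambda\to\mathfrak L_{\bar\lambda}$ is the isometry $V_\lambda P_{\mathfrak N_\lambda}h=P_{\mathfrak N_{\bar\lambda}}h$, $h\in\mathfrak L$. For $z\in\mathbb C\setminus\mathbb R$ the Shtraus extension $\widetilde S_z$ is defined by $\operatorname{dom}\widetilde S_z=\operatorname{dom}S\dot+\mathfrak N_z$, $\widetilde S_z(f_S+\varphi_z)=Sf_S+z\varphi_z$ ($f_S\in\operatorname{dom}S$, $\varphi_z\in\mathfrak N_z$); it is maximal dissipative for $z\in\mathbb C_+$ and $\widetilde S_z^*=\widetilde S_{\bar z}$. The characteristic function of $S$ (for fixed $\lambda\in\mathbb C_+$) is $C^S_\lambda(z)=(\widetilde S_z-\lambda I)(\widetilde S_z-\bar\lambda I)^{-1}\upharpoonright\mathfrak N_\lambda$, $z\in\mathbb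 C_+$; its values are bounded operators from $\mathfrak N_\lambda$ to $\mathfrak N_{\bar\lambda}$. "Non-tangential to the real axis" means: $z\to\infty$ inside any sector $\{z:\delta<\arg z<\pi-\delta\}$, $0<\delta<\pi/2$. *)

theory Defs
  imports "HOL-Analysis.Analysis"
begin

section \<open>Complex Hilbert spaces\<close>

class complex_vector = real_vector +
  fixes scaleC :: "complex \<Rightarrow> 'a \<Rightarrow> 'a" (infixr \<open>*\<^sub>C\<close> 75)
  assumes scaleC_add_right: "c *\<^sub>C (x + y) = c *\<^sub>C x + c *\<^sub>C y"
    and scaleC_add_left: "(c + d) *\<^sub>C x = c *\<^sub>C x + d *\<^sub>C x"
    and scaleC_scaleC: "c *\<^sub>C (d *\<^sub>C x) = (c * d) *\<^sub>C x"
    and scaleC_one: "1 *\<^sub>C x = x"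
    and scaleR_scaleC: "r *\<^sub>R x = complex_of_real r *\<^sub>C x"

global_interpretation complex_vector: vector_space "scaleC :: complex \<Rightarrow> 'a \<Rightarrow> 'a::complex_vector"
  by unfold_locales (simp_all add: scaleC_add_right scaleC_add_left scaleC_scaleC scaleC_one)

instantiation prod :: (complex_vector, complex_vector) complex_vector
begin

definition scaleC_prod :: "complex \<Rightarrow> 'a \<times> 'b \<Rightarrow> 'a \<times> 'b"
  where "scaleC_prod c p = (c *\<^sub>C fst p, c *\<^sub>C snd p)"

instance
  by standard
    (simp_all add: scaleC_prod_def prod_eq_iff scaleC_add_right scaleC_add_left
      scaleC_scaleC scaleC_one scaleR_scaleC)

end

text \<open>The complex inner product is linear in the first argument. Norm and topology come from the
  underlying real inner product, which is its real part; positive definiteness and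
  \<open>norm x = sqrt (Re (cinner x x))\<close> are inherited from \<^class>\<open>real_inner\<close>.\<close>

class complex_inner = complex_vector + real_inner +
  fixes cinner :: "'a \<Rightarrow> 'a \<Rightarrow> complex"
  assumes cinner_add_left: "cinner (x + y) z = cinner x z + cinner y z"
    and cinner_scaleC_left: "cinner (c *\<^sub>C x) y = c * cinner x y"
    and cinner_commute: "cinner x y = cnj (cinner y x)"
    and inner_eq_Re_cinner: "inner x y = Re (cinner x y)"

class complex_hilbert = complex_inner + complete_space

definition infinite_dimensional :: "'a::complex_vector itself \<Rightarrow> bool"
  where "infinite_dimensional _ \<longleftrightarrow>
    \<not> (\<exists>B :: 'a set. finite B \<and> complex_vector.span B = UNIV)"

definition ortho_compl :: "'a::complex_inner set \<Rightarrow> 'a set"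
  where "ortho_compl K = {x. \<forall>k\<in>K. cinner x k = 0}"

text \<open>Meaningful for a closed subspace \<open>K\<close> of a Hilbert space, where such a \<open>y\<close> exists uniquely.\<close>

definition proj :: "'a::complex_inner set \<Rightarrow> 'a \<Rightarrow> 'a"
  where "proj K x = (THE y. y \<in> K \<and> x - y \<in> ortho_compl K)"


section \<open>Operators as graphs\<close>

text \<open>A linear operator, not necessarily everywhere or densely defined, is identified with its
  graph. Its domain and range are \<^const>\<open>Domain\<close> and \<^const>\<open>Range\<close>, the identity is \<^const>\<open>Id\<close> and
  the inverse is \<^const>\<open>converse\<close>. Equality of operators thus includes equality of the domains.\<close>

definition linear_operator :: "('a::complex_vector \<times> 'a) set \<Rightarrow> bool"
  where "linear_operator T \<longleftrightarrow> complex_vector.subspace T \<and> single_valued T"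

text \<open>Meaningful only for \<open>x \<in> Domain T\<close> and single-valued \<open>T\<close>.\<close>

definition op_app :: "('a \<times> 'a) set \<Rightarrow> 'a \<Rightarrow> 'a"
  where "op_app T x = (THE y. (x, y) \<in> T)"

definition op_of :: "('a \<Rightarrow> 'a) \<Rightarrow> ('a \<times> 'a) set"
  where "op_of f = {(x, f x) | x. True}"

definition op_scale :: "complex \<Rightarrow> ('a::complex_vector \<times> 'a) set \<Rightarrow> ('a \<times> 'a) set"
    (infixr \<open>\<cdot>\<^sub>o\<close> 75)
  where "c \<cdot>\<^sub>o T = {(x, c *\<^sub>C y) | x y. (x, y) \<in> T}"

definition op_diff :: "('a::complex_vector \<times> 'a) set \<Rightarrow> ('a \<times> 'a) set \<Rightarrow> ('a \<times> 'a) set"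
    (infixl \<open>-\<^sub>o\<close> 65)
  where "T -\<^sub>o U = {(x, y - y') | x y y'. (x, y) \<in> T \<and> (x, y') \<in> U}"

text \<open>\<open>T \<circ>\<^sub>o U\<close> applies \<open>U\<close> first, whereas \<open>T O U\<close> would apply \<open>T\<close> first.\<close>

definition op_comp :: "('a \<times> 'a) set \<Rightarrow> ('a \<times> 'a) set \<Rightarrow> ('a \<times> 'a) set"
    (infixr \<open>\<circ>\<^sub>o\<close> 70)
  where "T \<circ>\<^sub>o U = U O T"

definition op_restrict :: "('a \<times> 'a) set \<Rightarrow> 'a set \<Rightarrow> ('a \<times> 'a) set"
    (infixl \<open>\<restriction>\<^sub>o\<close> 60)
  where "T \<restriction>\<^sub>o K = {(x, y). (x, y) \<in> T \<and> x \<in> K}"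

definition op_adjoint :: "('a::complex_inner \<times> 'a) set \<Rightarrow> ('a \<times> 'a) set"
  where "op_adjoint T = {(h, k). \<forall>(x, y)\<in>T. cinner y h = cinner x k}"

definition bounded_operator_between ::
    "'a::complex_inner set \<Rightarrow> 'a set \<Rightarrow> ('a \<times> 'a) set \<Rightarrow> bool"
  where "bounded_operator_between K L T \<longleftrightarrow>
    linear_operator T \<and> Domain T = K \<and> Range T \<subseteq> L \<and>
    (\<exists>B. \<forall>(x, y)\<in>T. norm y \<le> B * norm x)"

definition symmetric_operator :: "('a::complex_inner \<times> 'a) set \<Rightarrow> bool"
  where "symmetric_operator S \<longleftrightarrow>
    linear_operator S \<and> (\<forall>f\<in>Domain S. Im (cinner (op_app S f) f) = 0)"

definition closed_symmetric_operator :: "('a::complex_inner \<times> 'a) set \<Rightarrow> bool"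
  where "closed_symmetric_operator S \<longleftrightarrow> symmetric_operator S \<and> closed S"


section \<open>Defect subspaces, Shtraus extensions and the characteristic function\<close>

definition range_space :: "('a::complex_inner \<times> 'a) set \<Rightarrow> complex \<Rightarrow> 'a set"
  where "range_space S \<mu> = Range (S -\<^sub>o \<mu> \<cdot>\<^sub>o Id)"

definition defect_space :: "('a::complex_inner \<times> 'a) set \<Rightarrow> complex \<Rightarrow> 'a set"
  where "defect_space S \<mu> = ortho_compl (range_space S (cnj \<mu>))"

definition shtraus :: "('a::complex_inner \<times> 'a) set \<Rightarrow> complex \<Rightarrow> ('a \<times> 'a) set"
  where "shtraus S z =
    {(f + \<phi>, g + z *\<^sub>C \<phi>) | f g \<phi>. (f, g) \<in> S \<and> \<phi> \<in> defect_space S z}"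

definition cayley :: "('a::complex_inner \<times> 'a) set \<Rightarrow> complex \<Rightarrow> ('a \<times> 'a) set"
  where "cayley T \<mu> = (T -\<^sub>o \<mu> \<cdot>\<^sub>o Id) \<circ>\<^sub>o (T -\<^sub>o cnj \<mu> \<cdot>\<^sub>o Id)\<inverse>"

definition char_fun :: "('a::complex_inner \<times> 'a) set \<Rightarrow> complex \<Rightarrow> complex \<Rightarrow> ('a \<times> 'a) set"
  where "char_fun S \<mu> z = cayley (shtraus S z) \<mu> \<restriction>\<^sub>o defect_space S \<mu>"

definition dom_defect :: "('a::complex_inner \<times> 'a) set \<Rightarrow> 'a set"
  where "dom_defect S = ortho_compl (closure (Domain S))"

definition dom_defect_proj :: "('a::complex_inner \<times> 'a) set \<Rightarrow> complex \<Rightarrow> 'a set"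
  where "dom_defect_proj S \<mu> = proj (defect_space S \<mu>) ` dom_defect S"

definition V_op :: "('a::complex_inner \<times> 'a) set \<Rightarrow> complex \<Rightarrow> ('a \<times> 'a) set"
  where "V_op S \<mu> =
    {(proj (defect_space S \<mu>) h, proj (defect_space S (cnj \<mu>)) h) | h. h \<in> dom_defect S}"

definition nontangential_limit_at_infinity ::
    "(complex \<Rightarrow> 'a::topological_space) \<Rightarrow> 'a \<Rightarrow> bool"
  where "nontangential_limit_at_infinity F l \<longleftrightarrow>
    (\<forall>\<delta>. 0 < \<delta> \<and> \<delta> < pi / 2 \<longrightarrow>
      (F \<longlongrightarrow> l) (inf at_infinity (principal {z. \<delta> < Arg z \<and> Arg z < pi - \<delta>})))"

end

theory Submission
  imports Defs
begin

text \<open>Let \<open>W\<close> be the Cayley transform of \<open>S\<close>, an isometry of \<open>M = ran (S - cnj \<mu> I)\<close> onto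
  \<open>M' = ran (S - \<mu> I)\<close>. Then \<open>Y = W P\<^sub>M\<close>, and \<open>A = Y\<^sup>* = W\<^sup>-\<^sup>1 P\<^bsub>M'\<^esub>\<close> is a contraction. For
  \<open>w = (z - \<mu>) / (z - cnj \<mu>)\<close> an element \<open>\<psi>\<close> of the defect space of \<open>S\<close> at \<open>z\<close> is characterised by
  \<open>P\<^sub>M \<psi> = w A \<psi>\<close>, so the pairs in the Cayley transform of the Shtraus extension are
  \<open>(a + \<psi>, W a + w \<psi>)\<close>; the first component is orthogonal to \<open>M\<close> iff \<open>a = - w A \<psi>\<close>, and this is
  the formula for the characteristic function.

  A vector \<open>h\<close> orthogonal to \<open>dom S\<close> satisfies \<open>P\<^sub>M h = A h\<close>, hence
  \<open>(I - w A)\<^sup>-\<^sup>1 P\<^sub>N h = h - (1 - w) (I - w A)\<^sup>-\<^sup>1 A h\<close>. Non-tangential convergence of \<open>z\<close> to infinity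
  is convergence of \<open>w\<close> to \<open>1\<close> in a Stolz angle, where \<open>(1 - w) (I - w A)\<^sup>-\<^sup>1\<close> tends strongly to \<open>0\<close>
  because \<open>W\<close> has no fixed vector other than \<open>0\<close>.\<close>


section \<open>Complex inner products\<close>

lemma cinner_add_right: "cinner x (y + z) = cinner x y + cinner x z"
  for x :: "'a::complex_inner"
  by (metis cinner_add_left cinner_commute complex_cnj_add)

lemma cinner_scaleC_right: "cinner x (c *\<^sub>C y) = cnj c * cinner x y"
  for x :: "'a::complex_inner"
  by (metis cinner_commute cinner_scaleC_left complex_cnj_mult)

lemma cinner_zero_left [simp]: "cinner 0 x = 0" for x :: "'a::complex_inner"
  using cinner_add_left[of 0 0 x] by simp

lemma cinner_zero_right [simp]: "cinner x 0 = 0" for x :: "'a::complex_inner"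
  using cinner_add_right[of x 0 0] by simp

lemma cinner_minus_left: "cinner (- x) y = - cinner x y" for x :: "'a::complex_inner"
  using cinner_add_left[of x "- x" y] by (simp add: eq_neg_iff_add_eq_0 add.commute)

lemma cinner_minus_right: "cinner x (- y) = - cinner x y" for x :: "'a::complex_inner"
  using cinner_add_right[of x y "- y"] by (simp add: eq_neg_iff_add_eq_0 add.commute)

lemma cinner_diff_left: "cinner (x - y) z = cinner x z - cinner y z"
  for x :: "'a::complex_inner"
  using cinner_add_left[of x "- y" z] by (simp add: cinner_minus_left)

lemma cinner_diff_right: "cinner x (y - z) = cinner x y - cinner x z"
  for x :: "'a::complex_inner"
  using cinner_add_right[of x y "- z"] by (simp add: cinner_minus_right)

lemma cinner_self: "cinner x x = complex_of_real ((norm x)\<^sup>2)" for x :: "'a::complex_inner"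
proof (rule complex_eqI)
  show "Re (cinner x x) = Re (complex_of_real ((norm x)\<^sup>2))"
    by (simp add: inner_eq_Re_cinner[symmetric] power2_norm_eq_inner)
  have "cnj (cinner x x) = cinner x x"
    by (metis cinner_commute)
  then show "Im (cinner x x) = Im (complex_of_real ((norm x)\<^sup>2))"
    by (simp add: complex_eq_iff)
qed

lemma norm_eq_if_cinner_eq: "cinner x x = cinner y y \<Longrightarrow> norm x = norm y"
  for x y :: "'a::complex_inner"
  by (metis cinner_self norm_ge_zero of_real_eq_iff power2_eq_iff_nonneg)

lemma cinner_self_eq_0 [simp]: "cinner x x = 0 \<longleftrightarrow> x = 0" for x :: "'a::complex_inner"
  by (simp add: cinner_self)

lemma norm_scaleC: "norm (c *\<^sub>C x) = cmod c * norm x" for x :: "'a::complex_inner"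
proof -
  have "cinner (c *\<^sub>C x) (c *\<^sub>C x) = (c * cnj c) * cinner x x"
    by (simp add: cinner_scaleC_left cinner_scaleC_right)
  also have "\<dots> = complex_of_real ((cmod c * norm x)\<^sup>2)"
    by (simp add: cinner_self power_mult_distrib flip: complex_norm_square)
  finally show ?thesis
    unfolding cinner_self of_real_eq_iff by (simp add: power2_eq_iff_nonneg)
qed

lemma bounded_bilinear_scaleC: "bounded_bilinear (scaleC :: complex \<Rightarrow> 'a \<Rightarrow> 'a::complex_inner)"
proof
  show "\<exists>K. \<forall>c (x::'a). norm (c *\<^sub>C x) \<le> norm c * norm x * K"
    by (rule exI[of _ 1]) (simp add: norm_scaleC)
qed (simp_all add: scaleC_add_left scaleC_add_right scaleR_scaleC scaleC_scaleC
    scaleR_conv_of_real mult.commute)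

lemmas tendsto_scaleC = bounded_bilinear.tendsto[OF bounded_bilinear_scaleC]

lemma scaleC_zero_simps [simp]: "0 *\<^sub>C x = 0" "c *\<^sub>C 0 = 0"
  by (fact complex_vector.scale_zero_left complex_vector.scale_zero_right)+

lemmas scaleC_diff_left = complex_vector.scale_left_diff_distrib
lemmas scaleC_diff_right = complex_vector.scale_right_diff_distrib
lemmas scaleC_minus_left = complex_vector.scale_minus_left
lemmas scaleC_minus_right = complex_vector.scale_minus_right

lemmas scaleC_algebra = scaleC_diff_left scaleC_diff_right scaleC_add_left scaleC_add_right
  scaleC_scaleC scaleC_minus_left scaleC_minus_right


section \<open>Orthogonal projections\<close>

lemma subspace_ortho_compl: "complex_vector.subspace (ortho_compl K)"
  by (auto simp: complex_vector.subspace_def ortho_compl_def cinner_add_left cinner_scaleC_left)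

text \<open>Because \<open>K\<close> is closed under multiplication by \<open>\<i>\<close>, the
  imaginary part of \<open>cinner x k\<close> is the real part of
  \<open>cinner x (\<i> *\<^sub>C k)\<close>. Variational arguments can therefore use the real inner
  product alone.\<close>

lemma ortho_compl_iff_inner:
  fixes K :: "'a::complex_inner set"
  assumes "complex_vector.subspace K"
  shows "x \<in> ortho_compl K \<longleftrightarrow> (\<forall>k\<in>K. inner x k = 0)"
proof
  assume R: "\<forall>k\<in>K. inner x k = 0"
  have "cinner x k = 0" if k: "k \<in> K" for k
  proof (rule complex_eqI)
    show "Re (cinner x k) = Re 0"
      using R k by (simp add: inner_eq_Re_cinner)
    have "\<i> *\<^sub>C k \<in> K"
      using assms k by (auto simp: complex_vector.subspace_def)
    then show "Im (cinner x k) = Im 0"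
      using R by (force simp: inner_eq_Re_cinner cinner_scaleC_right)
  qed
  then show "x \<in> ortho_compl K"
    by (simp add: ortho_compl_def)
qed (simp add: ortho_compl_def inner_eq_Re_cinner)

lemma subspace_ortho_compl_Int:
  "x \<in> K \<Longrightarrow> x \<in> ortho_compl K \<Longrightarrow> x = 0"
  by (auto simp: ortho_compl_def)

text \<open>The sets \<open>B n\<close> of near-minimisers of the distance to \<open>x\<close> are
  closed and nested, and their diameters shrink. By completeness they share a point, which is a
  minimiser, and the first-order condition there is orthogonality.\<close>

theorem projection_exists:
  fixes K :: "'a::complex_hilbert set"
  assumes K: "complex_vector.subspace K" and "closed K"
  shows "\<exists>y\<in>K. x - y \<in> ortho_compl K"
proof -
  have K0: "0 \<in> K" and Kadd: "\<And>a b. a \<in> K \<Longrightarrow> b \<in> K \<Longrightarrow> a + b \<in> K"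
    and Kscale: "\<And>r a. a \<in> K \<Longrightarrow> r *\<^sub>R a \<in> K"
    using K by (auto simp: complex_vector.subspace_def scaleR_scaleC)
  define d where "d = (INF k\<in>K. (norm (x - k))\<^sup>2)"
  have bdd: "bdd_below ((\<lambda>k. (norm (x - k))\<^sup>2) ` K)"
    by (rule bdd_belowI[of _ 0]) auto
  have d_le: "d \<le> (norm (x - k))\<^sup>2" if "k \<in> K" for k
    unfolding d_def by (rule cINF_lower[OF bdd that])
  define B where "B n = K \<inter> {k. (norm (x - k))\<^sup>2 \<le> d + inverse (real (Suc n))}" for n
  have diam: "(dist a b)\<^sup>2 \<le> 4 * inverse (real (Suc n))" if "a \<in> B n" "b \<in> B n" for a b n
  proof -
    have "(1/2) *\<^sub>R (a + b) \<in> K"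
      using that Kadd Kscale by (simp add: B_def)
    then have "d \<le> (norm (x - (1/2) *\<^sub>R (a + b)))\<^sup>2"
      by (rule d_le)
    \<comment> \<open>Parallelogram law for \<open>x - a\<close> and \<open>x - b\<close>. The
      midpoint of \<open>a\<close> and \<open>b\<close> lies in \<open>K\<close>, so the subtracted
      term is at least \<open>4 * d\<close>.\<close>
    moreover have "(norm (a - b))\<^sup>2 =
        2 * (norm (x - a))\<^sup>2 + 2 * (norm (x - b))\<^sup>2 - 4 * (norm (x - (1/2) *\<^sub>R (a + b)))\<^sup>2"
      by (simp add: power2_norm_eq_inner inner_diff_left inner_diff_right inner_add_left
          inner_add_right inner_commute field_simps)
    ultimately show ?thesis
      using that by (auto simp: B_def dist_norm)
  qed
  obtain y where y: "\<And>n. y \<in> B n"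
  proof (rule decreasing_closed_nest[of B])
    show "closed (B n)" for n
      unfolding B_def by (intro closed_Int assms(2) closed_Collect_le continuous_intros)
    show "B n \<noteq> {}" for n
    proof -
      have "d < d + inverse (real (Suc n))" by simp
      then obtain k where "k \<in> K" "(norm (x - k))\<^sup>2 < d + inverse (real (Suc n))"
        unfolding d_def using K0 by (subst (asm) cINF_less_iff[OF _ bdd]) auto
      then show ?thesis
        by (auto simp: B_def intro!: less_imp_le)
    qed
    show "B n \<subseteq> B m" if "m \<le> n" for m n
    proof -
      have "inverse (real (Suc n)) \<le> inverse (real (Suc m))"
        using that by (simp add: field_simps)
      then show ?thesis
        unfolding B_def by (auto simp del: of_nat_Suc intro: order_trans)
    qed
    show "\<exists>n. \<forall>a\<in>B n. \<forall>b\<in>B n. dist a b < e" if e: "e > 0" for e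
    proof -
      obtain n where "inverse (real (Suc n)) < e\<^sup>2 / 4"
        using reals_Archimedean[of "e\<^sup>2 / 4"] e by auto
      then have "(dist a b)\<^sup>2 < e\<^sup>2" if "a \<in> B n" "b \<in> B n" for a b
        using diam[OF that] by linarith
      then show ?thesis
        using e by (meson less_imp_le power2_less_imp_less)
    qed
  qed blast
  have "y \<in> K" using y by (auto simp: B_def)
  have "(norm (x - y))\<^sup>2 \<le> d"
  proof (rule field_le_epsilon)
    fix e :: real assume "e > 0"
    then obtain n where "inverse (real (Suc n)) < e"
      using reals_Archimedean by blast
    then show "(norm (x - y))\<^sup>2 \<le> d + e"
      using y[of n] by (simp add: B_def)
  qed
  have "inner (x - y) k = 0" if "k \<in> K" for k
  proof -
    define a b where "a = inner (x - y) k" and "b = inner k k"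
    have "b \<ge> 0" by (simp add: b_def)
    \<comment> \<open>A step in direction \<open>k\<close> that is short enough to contradict
      minimality unless \<open>a = 0\<close>. The summand 1 keeps the denominator positive when
      \<open>k = 0\<close>.\<close>
    define t where "t = a / (b + 1)"
    have "(norm (x - y))\<^sup>2 \<le> (norm (x - (y + t *\<^sub>R k)))\<^sup>2"
      using \<open>(norm (x - y))\<^sup>2 \<le> d\<close> d_le[OF Kadd[OF \<open>y \<in> K\<close> Kscale[OF that]], of t] by linarith
    also have "\<dots> = (norm (x - y))\<^sup>2 - 2 * t * a + t\<^sup>2 * b"
      unfolding power2_norm_eq_inner a_def b_def
      by (simp add: inner_diff_left inner_diff_right inner_add_left
          inner_add_right inner_commute power2_eq_square algebra_simps)
    finally have "2 * t * a \<le> t\<^sup>2 * b" by linarith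
    moreover have a: "a = t * (b + 1)" using \<open>b \<ge> 0\<close> by (simp add: t_def)
    ultimately have "t\<^sup>2 * (b + 2) \<le> 0"
      by (simp add: power2_eq_square algebra_simps)
    then have "t = 0" using \<open>b \<ge> 0\<close>
      by (smt (verit) mult_pos_pos zero_less_power2)
    then show ?thesis using a by (simp add: a_def)
  qed
  with \<open>y \<in> K\<close> show ?thesis
    using ortho_compl_iff_inner[OF K] by blast
qed

lemma proj_eqI:
  assumes "complex_vector.subspace K" "y \<in> K" "x - y \<in> ortho_compl K"
  shows "proj K x = y"
  unfolding proj_def
proof (rule the_equality)
  fix y' assume y': "y' \<in> K \<and> x - y' \<in> ortho_compl K"
  have "y' - y \<in> K"
    using assms y' by (auto intro: complex_vector.subspace_diff)
  moreover have "(x - y) - (x - y') \<in> ortho_compl K"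
    using assms y' subspace_ortho_compl by (blast intro: complex_vector.subspace_diff)
  ultimately show "y' = y"
    using subspace_ortho_compl_Int by fastforce
qed (use assms in simp)

lemma
  fixes K :: "'a::complex_hilbert set"
  assumes "complex_vector.subspace K" "closed K"
  shows proj_in: "proj K x \<in> K" and diff_proj_in: "x - proj K x \<in> ortho_compl K"
  using projection_exists[OF assms, of x] proj_eqI[OF assms(1)] by metis+

lemma ortho_complD: "x \<in> ortho_compl K \<Longrightarrow> k \<in> K \<Longrightarrow> cinner x k = 0"
  by (simp add: ortho_compl_def)

lemma ortho_complD': "x \<in> ortho_compl K \<Longrightarrow> k \<in> K \<Longrightarrow> cinner k x = 0"
  by (metis cinner_commute complex_cnj_zero ortho_complD)

text \<open>This lets the projections onto the defect spaces be treated as the identity minus the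
  projection onto a range space.\<close>

lemma proj_ortho_compl:
  fixes K :: "'a::complex_hilbert set"
  assumes "complex_vector.subspace K" "closed K"
  shows "proj (ortho_compl K) x = x - proj K x"
  using proj_in[OF assms, of x] diff_proj_in[OF assms, of x]
  by (intro proj_eqI subspace_ortho_compl) (auto simp: ortho_compl_def intro: ortho_complD')

lemma proj_module_hom:
  fixes K :: "'a::complex_hilbert set"
  assumes "complex_vector.subspace K" "closed K"
  shows "module_hom scaleC scaleC (proj K)"
proof -
  note in1 = proj_in[OF assms] and in2 = diff_proj_in[OF assms]
  have "proj K (x + y) = proj K x + proj K y" for x y
  proof (rule proj_eqI[OF assms(1)])
    show "x + y - (proj K x + proj K y) \<in> ortho_compl K"
      using complex_vector.subspace_add[OF subspace_ortho_compl in2[of x] in2[of y]] by (simp add: algebra_simps)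
  qed (intro complex_vector.subspace_add assms in1)
  moreover have "proj K (c *\<^sub>C x) = c *\<^sub>C proj K x" for c x
  proof (rule proj_eqI[OF assms(1)])
    show "c *\<^sub>C x - c *\<^sub>C proj K x \<in> ortho_compl K"
      using complex_vector.subspace_scale[OF subspace_ortho_compl in2[of x], of c] by (simp add: scaleC_diff_right)
  qed (intro complex_vector.subspace_scale assms in1)
  ultimately show ?thesis
    by (simp add: module_hom_iff complex_vector.module_axioms)
qed

lemma norm_Pythagoras:
  fixes x y :: "'a::complex_inner"
  assumes "cinner x y = 0"
  shows "(norm (x + y))\<^sup>2 = (norm x)\<^sup>2 + (norm y)\<^sup>2"
  using assms by (simp add: power2_norm_eq_inner inner_add_left inner_add_right inner_commute
      inner_eq_Re_cinner[of x y])

lemma norm_proj_Pythagoras: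
  fixes K :: "'a::complex_hilbert set"
  assumes "complex_vector.subspace K" "closed K"
  shows "(norm x)\<^sup>2 = (norm (proj K x))\<^sup>2 + (norm (x - proj K x))\<^sup>2"
  using norm_Pythagoras[OF ortho_complD'[OF diff_proj_in[OF assms] proj_in[OF assms]], of x x]
  by simp

lemma norm_proj_le:
  fixes K :: "'a::complex_hilbert set"
  assumes "complex_vector.subspace K" "closed K"
  shows "norm (proj K x) \<le> norm x"
  by (rule power2_le_imp_le) (use norm_proj_Pythagoras[OF assms, of x] in auto)

text \<open>The closure is again a subspace, so every vector splits along it. The remainder is
  orthogonal to \<open>K\<close> and hence zero.\<close>

lemma dense_if_ortho_compl_trivial:
  fixes K :: "'a::complex_hilbert set"
  assumes K: "complex_vector.subspace K" and 0: "ortho_compl K \<subseteq> {0}"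
  shows "closure K = UNIV"
proof -
  have "complex_vector.subspace (closure K)"
    unfolding complex_vector.subspace_def
  proof (intro conjI ballI allI)
    show "0 \<in> closure K"
      using complex_vector.subspace_0[OF K] closure_subset by blast
    fix x assume "x \<in> closure K"
    then obtain f where f: "\<And>n. f n \<in> K" "f \<longlonglongrightarrow> x"
      by (auto simp: closure_sequential)
    show "c *\<^sub>C x \<in> closure K" for c
      unfolding closure_sequential
      by (intro exI[of _ "\<lambda>n. c *\<^sub>C f n"] conjI allI tendsto_scaleC tendsto_const
          complex_vector.subspace_scale K f)
    fix y assume "y \<in> closure K"
    then obtain g where g: "\<And>n. g n \<in> K" "g \<longlonglongrightarrow> y"
      by (auto simp: closure_sequential)
    show "x + y \<in> closure K"
      unfolding closure_sequential
      by (intro exI[of _ "\<lambda>n. f n + g n"] conjI allI tendsto_add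
          complex_vector.subspace_add K f g)
  qed
  then have *: "\<exists>y\<in>closure K. x - y \<in> ortho_compl (closure K)" for x
    by (rule projection_exists) simp
  have "ortho_compl (closure K) \<subseteq> ortho_compl K"
    using closure_subset by (force simp: ortho_compl_def)
  with * 0 show ?thesis by force
qed


lemma module_hom_subspace_range_diff:
  fixes A :: "'b::complex_vector \<Rightarrow> 'b"
  assumes "module_hom scaleC scaleC A"
  shows "complex_vector.subspace (range (\<lambda>x. x - A x))"
  unfolding complex_vector.subspace_def
proof (intro conjI ballI allI)
  show "0 \<in> range (\<lambda>x. x - A x)"
    by (rule range_eqI[of _ _ 0]) (simp add: module_hom.zero[OF assms])
  fix p assume "p \<in> range (\<lambda>x. x - A x)"
  then obtain x where x: "p = x - A x" by blast
  show "c *\<^sub>C p \<in> range (\<lambda>x. x - A x)" for c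
    by (rule range_eqI[of _ _ "c *\<^sub>C x"]) (simp add: x module_hom.scale[OF assms] scaleC_diff_right)
  fix q assume "q \<in> range (\<lambda>x. x - A x)"
  then obtain y where y: "q = y - A y" by blast
  show "p + q \<in> range (\<lambda>x. x - A x)"
    by (rule range_eqI[of _ _ "x + y"]) (simp add: x y module_hom.add[OF assms])
qed


section \<open>Resolvents of contractions\<close>

context
  fixes A :: "'a::complex_hilbert \<Rightarrow> 'a"
  assumes hom: "module_hom scaleC scaleC A"
    and contraction: "norm (A x) \<le> norm x"
begin

text \<open>This lower bound provides both the injectivity of I - wA and the bound 1/(1 - |w|) for
  its inverse when |w| < 1.\<close>

lemma resolvent_norm_le: "(1 - cmod w) * norm u \<le> norm (u - w *\<^sub>C A u)"
proof -
  have "norm (w *\<^sub>C A u) \<le> cmod w * norm u"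
    by (simp add: norm_scaleC contraction mult_left_mono)
  moreover have "norm u - norm (w *\<^sub>C A u) \<le> norm (u - w *\<^sub>C A u)"
    by (rule norm_triangle_ineq2)
  ultimately show ?thesis
    by (simp add: algebra_simps)
qed

text \<open>A solution is a fixed point of \<open>u \<mapsto> b + w *\<^sub>C A u\<close>, a strict
  contraction with factor |w|, so Banach's theorem applies.\<close>

lemma resolvent_exists:
  assumes "cmod w < 1"
  shows "\<exists>u. u - w *\<^sub>C A u = b"
proof -
  have "dist (b + w *\<^sub>C A x) (b + w *\<^sub>C A y) \<le> cmod w * dist x y" for x y
  proof -
    have "dist (b + w *\<^sub>C A x) (b + w *\<^sub>C A y) = cmod w * norm (A (x - y))"
      by (simp add: dist_norm module_hom.diff[OF hom] flip: scaleC_diff_right norm_scaleC)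
    also have "\<dots> \<le> cmod w * dist x y"
      by (simp add: dist_norm contraction mult_left_mono)
    finally show ?thesis .
  qed
  then have "\<exists>!u. b + w *\<^sub>C A u = u"
    by (intro banach_fix_type[where c = "cmod w"]) (use assms in auto)
  then obtain u where "b + w *\<^sub>C A u = u" by blast
  then have "u - w *\<^sub>C A u = b" by (simp add: algebra_simps)
  then show ?thesis ..
qed

lemma resolvent_unique:
  assumes "cmod w < 1" "u - w *\<^sub>C A u = v - w *\<^sub>C A v"
  shows "u = v"
proof -
  have "(u - v) - w *\<^sub>C A (u - v) = 0"
    using assms(2) by (simp add: module_hom.diff[OF hom] scaleC_diff_right algebra_simps)
  then show ?thesis
    using resolvent_norm_le[of w "u - v"] assms(1) by (simp add: mult_le_0_iff)
qed

text \<open>The graph is that of c B (I - wA)^{-1} restricted to \<open>N\<close>, parametrised by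
  the value \<open>u\<close> of the resolvent. It covers the resolvent itself, with \<open>B\<close>
  the identity, as well as the characteristic function, with \<open>B\<close> a projection.\<close>

lemma bounded_operator_between_resolvent:
  assumes B: "module_hom scaleC scaleC B" "\<And>x. norm (B x) \<le> norm x" "\<And>x. B x \<in> L"
    and N: "complex_vector.subspace N" and L: "complex_vector.subspace L" and w: "cmod w < 1"
  shows "bounded_operator_between N L
    {(x, y). x \<in> N \<and> (\<exists>u. x = u - w *\<^sub>C A u \<and> y = c *\<^sub>C B u)}" (is "bounded_operator_between N L ?T")
  unfolding bounded_operator_between_def linear_operator_def
proof (intro conjI)
  show "complex_vector.subspace ?T"
    unfolding complex_vector.subspace_def
  proof (intro conjI ballI allI)
    show "0 \<in> ?T"
      using complex_vector.subspace_0[OF N]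
      by (auto intro!: exI[of _ 0] simp: module_hom.zero[OF hom] module_hom.zero[OF B(1)] zero_prod_def)
    fix p assume p: "p \<in> ?T"
    then obtain u where u: "u - w *\<^sub>C A u \<in> N" "p = (u - w *\<^sub>C A u, c *\<^sub>C B u)"
      by auto
    show "a *\<^sub>C p \<in> ?T" for a
      using complex_vector.subspace_scale[OF N u(1), of a]
      by (auto intro!: exI[of _ "a *\<^sub>C u"] simp: u(2) scaleC_prod_def module_hom.scale[OF hom]
          module_hom.scale[OF B(1)] scaleC_algebra mult.commute)
    fix q assume "q \<in> ?T"
    then obtain v where v: "v - w *\<^sub>C A v \<in> N" "q = (v - w *\<^sub>C A v, c *\<^sub>C B v)"
      by auto
    show "p + q \<in> ?T"
      using complex_vector.subspace_add[OF N u(1) v(1)]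
      by (auto intro!: exI[of _ "u + v"] simp: u(2) v(2) module_hom.add[OF hom]
          module_hom.add[OF B(1)] scaleC_algebra algebra_simps)
  qed
  show "single_valued ?T"
    by (auto simp: single_valued_def dest: resolvent_unique[OF w])
  show "Domain ?T = N"
  proof (intro subset_antisym subsetI)
    fix x assume "x \<in> N"
    moreover obtain u where "x = u - w *\<^sub>C A u"
      using resolvent_exists[OF w, of x] by metis
    ultimately show "x \<in> Domain ?T" by (auto simp: Domain_iff)
  qed auto
  show "Range ?T \<subseteq> L"
    using B(3) complex_vector.subspace_scale[OF L] by auto
  have "norm (c *\<^sub>C B u) \<le> cmod c / (1 - cmod w) * norm (u - w *\<^sub>C A u)" for u
  proof -
    have "norm u \<le> norm (u - w *\<^sub>C A u) / (1 - cmod w)"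
      using resolvent_norm_le[of w u] w by (simp add: field_simps)
    then have "cmod c * norm (B u) \<le> cmod c * (norm (u - w *\<^sub>C A u) / (1 - cmod w))"
      using B(2)[of u] by (intro mult_left_mono) auto
    then show ?thesis
      by (simp add: norm_scaleC)
  qed
  then show "\<exists>C. \<forall>(x, y)\<in>?T. norm y \<le> C * norm x"
    by (intro exI[of _ "cmod c / (1 - cmod w)"]) auto
qed

text \<open>An Abel version of the mean ergodic theorem, inside a Stolz angle at \<open>1\<close>: up to
  \<open>O(1 - w)\<close>, the element \<open>(1 - w) g\<close> is the image of \<open>g - A g\<close> under
  \<open>(1 - w) (1 - w A)\<^sup>-\<^sup>1\<close>, and these operators are uniformly bounded.\<close>

lemma tendsto_resolvent_Stolz:
  fixes w :: "'b \<Rightarrow> complex"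
  assumes dense: "closure (range (\<lambda>x. x - A x)) = UNIV"
    and w: "(w \<longlongrightarrow> 1) F"
    and Stolz: "\<forall>\<^sub>F t in F. cmod (1 - w t) \<le> C * (1 - cmod (w t))"
    and u: "\<forall>\<^sub>F t in F. u t - w t *\<^sub>C A (u t) = b"
    and "C > 0"
  shows "((\<lambda>t. (1 - w t) *\<^sub>C u t) \<longlongrightarrow> 0) F"
proof (rule tendstoI)
  fix e :: real assume "e > 0"
  have "b \<in> closure (range (\<lambda>x. x - A x))"
    by (simp add: dense)
  \<comment> \<open>After multiplication by the Stolz constant \<open>C\<close>, this error still
    contributes less than e/2.\<close>
  then obtain g where g: "norm (b - (g - A g)) < e / (2 * C)"
    unfolding closure_approachable
    using \<open>e > 0\<close> \<open>C > 0\<close> by (force simp: dist_norm norm_minus_commute)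
  have "((\<lambda>t. cmod (1 - w t) * (norm g + C * norm (A g))) \<longlongrightarrow> cmod (1 - 1) * (norm g + C * norm (A g))) F"
    by (intro tendsto_intros w)
  then have "\<forall>\<^sub>F t in F. cmod (1 - w t) * (norm g + C * norm (A g)) < e / 2"
    by (rule order_tendstoD) (use \<open>e > 0\<close> in simp)
  then show "\<forall>\<^sub>F t in F. dist ((1 - w t) *\<^sub>C u t) 0 < e"
    using Stolz u
  proof eventually_elim
    case (elim t)
    let ?w = "w t" and ?u = "u t"
    \<comment> \<open>\<open>g\<close> is an approximate solution: its defect consists of the
      approximation error and a term of order 1 - w. The factor 1 - w in front of \<open>u\<close>
      then absorbs the resolvent bound, up to the constant \<open>C\<close>.\<close>
    have *: "(?u - g) - ?w *\<^sub>C A (?u - g) = (b - (g - A g)) - (1 - ?w) *\<^sub>C A g"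
      unfolding elim(3)[symmetric]
      by (simp add: module_hom.diff[OF hom] scaleC_algebra scaleC_one algebra_simps)
    have "(1 - cmod ?w) * norm (?u - g) \<le> norm ((b - (g - A g)) - (1 - ?w) *\<^sub>C A g)"
      using resolvent_norm_le[of ?w "?u - g"] unfolding * .
    also have "\<dots> \<le> norm (b - (g - A g)) + cmod (1 - ?w) * norm (A g)"
      unfolding norm_scaleC[symmetric] by (rule norm_triangle_ineq4)
    finally have "(1 - cmod ?w) * norm (?u - g) \<le> norm (b - (g - A g)) + cmod (1 - ?w) * norm (A g)" .
    then have "C * ((1 - cmod ?w) * norm (?u - g))
        \<le> C * (norm (b - (g - A g)) + cmod (1 - ?w) * norm (A g))"
      using \<open>C > 0\<close> by simp
    moreover have "cmod (1 - ?w) * norm (?u - g) \<le> C * (1 - cmod ?w) * norm (?u - g)"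
      using elim(2) by (rule mult_right_mono) simp
    moreover have "C * norm (b - (g - A g)) < e / 2"
      using g \<open>C > 0\<close> by (simp add: field_simps)
    moreover have "norm ((1 - ?w) *\<^sub>C ?u) \<le> cmod (1 - ?w) * norm (?u - g) + cmod (1 - ?w) * norm g"
      using norm_triangle_ineq[of "(1 - ?w) *\<^sub>C (?u - g)" "(1 - ?w) *\<^sub>C g"]
      by (simp add: scaleC_diff_right flip: norm_scaleC)
    ultimately have "norm ((1 - ?w) *\<^sub>C ?u) < e"
      using elim(1) by (simp add: algebra_simps)
    then show ?case by simp
  qed
qed

end


section \<open>Approaching infinity in a sector\<close>

text \<open>The squared distances of \<open>z\<close> to \<open>cnj \<mu>\<close> and to
  \<open>\<mu>\<close> differ by 4 Im z Im \<mu>, which is positive.\<close>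

lemma cmod_Moebius_less_1:
  assumes "Im \<mu> > 0" "Im z > 0"
  shows "cmod ((z - \<mu>) / (z - cnj \<mu>)) < 1"
proof -
  have "(cmod (z - \<mu>))\<^sup>2 < (cmod (z - cnj \<mu>))\<^sup>2"
    using mult_pos_pos[OF assms] by (simp add: cmod_power2) (simp add: power2_eq_square algebra_simps)
  then have "cmod (z - \<mu>) < cmod (z - cnj \<mu>)"
    by (rule power2_less_imp_less) simp
  then show ?thesis
    by (simp add: norm_divide divide_less_eq_1 order.strict_trans1[OF norm_ge_zero])
qed

lemma sin_le_in_sector:
  assumes "0 < \<delta>" "\<delta> < Arg z" "Arg z < pi - \<delta>"
  shows "cmod z * sin \<delta> \<le> Im z"
proof -
  have "sin \<delta> \<le> sin (Arg z)"
  proof (cases "Arg z \<le> pi / 2")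
    case True
    then show ?thesis using assms by (intro sin_monotone_2pi_le) auto
  next
    case False
    then have "sin \<delta> \<le> sin (pi - Arg z)" using assms by (intro sin_monotone_2pi_le) auto
    then show ?thesis by simp
  qed
  then have "cmod z * sin \<delta> \<le> cmod z * sin (Arg z)"
    by (simp add: mult_left_mono)
  also have "\<dots> = Im z"
    by (metis Im_rcis rcis_cmod_Arg)
  finally show ?thesis .
qed

text \<open>With p and q the distances of \<open>z\<close> to \<open>\<mu>\<close> and
  \<open>cnj \<mu>\<close>, one has |1 - w| = 2 Im \<mu> / q and 1 - |w| = (q - p) / q. From (q -
  p)(q + p) = 4 Im z Im \<mu> and q + p \<le> 4 |z| it follows that q - p \<ge> s Im \<mu>.\<close>

lemma cmod_Moebius_Stolz:
  assumes "Im \<mu> > 0" "Im z > 0" "cmod \<mu> \<le> cmod z" "cmod z * s \<le> Im z" "s > 0"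
  defines "w \<equiv> (z - \<mu>) / (z - cnj \<mu>)"
  shows "cmod (1 - w) \<le> 2 / s * (1 - cmod w)"
proof -
  define p q where "p = cmod (z - \<mu>)" and "q = cmod (z - cnj \<mu>)"
  have ne: "z \<noteq> cnj \<mu>" using assms(1,2) by auto
  then have "q > 0" by (simp add: q_def)
  have "p \<ge> 0" by (simp add: p_def)
  have pq: "q\<^sup>2 - p\<^sup>2 = 4 * Im z * Im \<mu>"
    by (simp add: p_def q_def cmod_power2) (simp add: power2_eq_square algebra_simps)
  have "p \<le> 2 * cmod z" "q \<le> 2 * cmod z"
    using norm_triangle_ineq4[of z \<mu>] norm_triangle_ineq4[of z "cnj \<mu>"] assms(3)
    by (auto simp: p_def q_def)
  then have "s * (q + p) \<le> s * (4 * cmod z)"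
    using \<open>s > 0\<close> by (intro mult_left_mono) auto
  then have "s * (q + p) \<le> 4 * Im z"
    using assms(4) by (simp add: mult_ac)
  then have "Im \<mu> * (s * (q + p)) \<le> Im \<mu> * (4 * Im z)"
    using \<open>Im \<mu> > 0\<close> by (intro mult_left_mono) auto
  also have "\<dots> = (q - p) * (q + p)"
    using pq by (simp add: power2_eq_square algebra_simps)
  finally have "Im \<mu> * s * (q + p) \<le> (q - p) * (q + p)"
    by (simp add: mult_ac)
  then have *: "Im \<mu> * s \<le> q - p"
    using \<open>q > 0\<close> \<open>p \<ge> 0\<close> by simp
  have "1 - w = (\<mu> - cnj \<mu>) / (z - cnj \<mu>)"
    using ne by (simp add: w_def field_simps)
  then have "cmod (1 - w) = 2 * Im \<mu> / q"
    using \<open>Im \<mu> > 0\<close> by (simp add: norm_divide q_def complex_diff_cnj norm_mult)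
  also have "\<dots> \<le> 2 * ((q - p) / s) / q"
    using * \<open>s > 0\<close> \<open>q > 0\<close> by (intro divide_right_mono mult_left_mono) (auto simp: field_simps)
  also have "\<dots> = 2 / s * (1 - cmod w)"
    using \<open>q > 0\<close> by (simp add: w_def norm_divide flip: p_def q_def) (simp add: field_simps)
  finally show ?thesis .
qed

lemma tendsto_Moebius_at_infinity:
  "((\<lambda>z. (z - \<mu>) / (z - cnj \<mu>)) \<longlongrightarrow> 1) at_infinity"
proof -
  have "filterlim (\<lambda>z. - cnj \<mu> + z) at_infinity at_infinity"
    by (rule tendsto_add_filterlim_at_infinity[OF tendsto_const filterlim_ident])
  then have "((\<lambda>z. 1 - (\<mu> - cnj \<mu>) / (- cnj \<mu> + z)) \<longlongrightarrow> 1 - 0) at_infinity"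
    by (intro tendsto_diff tendsto_const tendsto_divide_0[OF tendsto_const])
  \<comment> \<open>At \<open>z = cnj \<mu>\<close> division by zero makes the left side 1 and the
    right side 0, so the identity is only claimed eventually.\<close>
  moreover have "\<forall>\<^sub>F z in at_infinity. 1 - (\<mu> - cnj \<mu>) / (- cnj \<mu> + z) = (z - \<mu>) / (z - cnj \<mu>)"
    using eventually_not_equal_at_infinity[of "cnj \<mu>"]
    by eventually_elim (simp add: field_simps)
  ultimately show ?thesis
    by (simp add: tendsto_cong)
qed


section \<open>Range spaces of closed symmetric operators\<close>

lemma linear_operatorD:
  assumes "linear_operator T"
  shows "(0, 0) \<in> T"
    and "(f, g) \<in> T \<Longrightarrow> (f', g') \<in> T \<Longrightarrow> (f + f', g + g') \<in> T"
    and "(f, g) \<in> T \<Longrightarrow> (f', g') \<in> T \<Longrightarrow> (f - f', g - g') \<in> T"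
    and "(f, g) \<in> T \<Longrightarrow> (c *\<^sub>C f, c *\<^sub>C g) \<in> T"
    and "(f, g) \<in> T \<Longrightarrow> (f, g') \<in> T \<Longrightarrow> g = g'"
proof -
  have T: "complex_vector.subspace T"
    using assms by (simp add: linear_operator_def)
  show "(0, 0) \<in> T"
    using complex_vector.subspace_0[OF T] by (simp add: zero_prod_def)
  show "(f, g) \<in> T \<Longrightarrow> (f', g') \<in> T \<Longrightarrow> (f + f', g + g') \<in> T"
    using complex_vector.subspace_add[OF T, of "(f, g)" "(f', g')"] by simp
  show "(f, g) \<in> T \<Longrightarrow> (f', g') \<in> T \<Longrightarrow> (f - f', g - g') \<in> T"
    using complex_vector.subspace_diff[OF T, of "(f, g)" "(f', g')"] by simp
  show "(f, g) \<in> T \<Longrightarrow> (c *\<^sub>C f, c *\<^sub>C g) \<in> T"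
    using complex_vector.subspace_scale[OF T, of "(f, g)" c] by (simp add: scaleC_prod_def)
  show "(f, g) \<in> T \<Longrightarrow> (f, g') \<in> T \<Longrightarrow> g = g'"
    using assms by (auto simp: linear_operator_def single_valued_def)
qed

lemma op_diff_scale_Id_iff:
  "(x, y) \<in> T -\<^sub>o c \<cdot>\<^sub>o Id \<longleftrightarrow> (\<exists>v. (x, v) \<in> T \<and> y = v - c *\<^sub>C x)"
  by (auto simp: op_diff_def op_scale_def)

lemma range_space_iff: "x \<in> range_space S \<nu> \<longleftrightarrow> (\<exists>f g. (f, g) \<in> S \<and> x = g - \<nu> *\<^sub>C f)"
  unfolding range_space_def Range_iff op_diff_scale_Id_iff by blast

lemma defect_space_iff:
  "x \<in> defect_space S \<nu> \<longleftrightarrow> (\<forall>f g. (f, g) \<in> S \<longrightarrow> cinner x (g - cnj \<nu> *\<^sub>C f) = 0)"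
  unfolding defect_space_def ortho_compl_def mem_Collect_eq Ball_def range_space_iff by blast

lemma shtraus_iff:
  "(x, y) \<in> shtraus S z \<longleftrightarrow>
    (\<exists>f g \<phi>. (f, g) \<in> S \<and> \<phi> \<in> defect_space S z \<and> x = f + \<phi> \<and> y = g + z *\<^sub>C \<phi>)"
  by (auto simp: shtraus_def)

text \<open>The two factors each supply an image of \<open>u\<close> under \<open>T\<close>;
  single-valuedness identifies them, so one \<open>v\<close> serves both.\<close>

lemma cayley_iff:
  assumes "single_valued T"
  shows "(x, y) \<in> cayley T \<nu> \<longleftrightarrow>
    (\<exists>u v. (u, v) \<in> T \<and> x = v - cnj \<nu> *\<^sub>C u \<and> y = v - \<nu> *\<^sub>C u)"
proof -
  have "(x, y) \<in> cayley T \<nu> \<longleftrightarrow>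
      (\<exists>u. (u, x) \<in> T -\<^sub>o cnj \<nu> \<cdot>\<^sub>o Id \<and> (u, y) \<in> T -\<^sub>o \<nu> \<cdot>\<^sub>o Id)"
    by (simp add: cayley_def op_comp_def relcomp_unfold)
  also have "\<dots> \<longleftrightarrow> (\<exists>u v. (u, v) \<in> T \<and> x = v - cnj \<nu> *\<^sub>C u \<and> y = v - \<nu> *\<^sub>C u)"
    unfolding op_diff_scale_Id_iff by (metis single_valuedD[OF assms])
  finally show ?thesis .
qed

context
  fixes S :: "('a::complex_hilbert \<times> 'a) set"
  assumes closed_sym: "closed_symmetric_operator S"
begin

lemma linear_op: "linear_operator S"
  using closed_sym by (simp add: closed_symmetric_operator_def symmetric_operator_def)

lemma symmetric_quadratic_form: "(f, g) \<in> S \<Longrightarrow> Im (cinner g f) = 0"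
proof -
  assume fg: "(f, g) \<in> S"
  then have "op_app S f = g"
    unfolding op_app_def using linear_operatorD(5)[OF linear_op] by blast
  then show ?thesis
    using closed_sym fg by (force simp: closed_symmetric_operator_def symmetric_operator_def)
qed

text \<open>Polarisation: the quadratic form is real at f + cf' for c = 1 and c = i, which settles
  the imaginary and the real part.\<close>

lemma symmetric_cinner:
  assumes "(f, g) \<in> S" "(f', g') \<in> S"
  shows "cinner g f' = cinner f g'"
proof -
  have 0: "Im (cinner g f) = 0" "Im (cinner g' f') = 0"
    using assms by (simp_all add: symmetric_quadratic_form)
  have "Im (cinner (g + c *\<^sub>C g') (f + c *\<^sub>C f')) = 0" for c
    using assms linear_operatorD[OF linear_op] by (intro symmetric_quadratic_form) blast
  from this[of 1] this[of \<i>] 0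
  have "Im (cinner g f') + Im (cinner g' f) = 0" "Re (cinner g' f) - Re (cinner g f') = 0"
    by (simp_all add: cinner_add_left cinner_add_right cinner_scaleC_left cinner_scaleC_right scaleC_one)
  then have "cinner g f' = cnj (cinner g' f)"
    by (simp add: complex_eq_iff)
  then show ?thesis
    by (metis cinner_commute)
qed

lemma subspace_range_space: "complex_vector.subspace (range_space S \<nu>)"
  unfolding complex_vector.subspace_def
proof (intro conjI ballI allI)
  show "0 \<in> range_space S \<nu>"
    unfolding range_space_iff using linear_operatorD(1)[OF linear_op]
    by (intro exI[of _ 0]) simp
  fix x assume "x \<in> range_space S \<nu>"
  then obtain f g where fg: "(f, g) \<in> S" "x = g - \<nu> *\<^sub>C f"
    by (auto simp: range_space_iff)
  show "c *\<^sub>C x \<in> range_space S \<nu>" for c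
    unfolding range_space_iff
    by (intro exI[of _ "c *\<^sub>C f"] exI[of _ "c *\<^sub>C g"] conjI linear_operatorD(4)[OF linear_op fg(1)])
      (simp add: fg(2) scaleC_algebra mult.commute)
  fix y assume "y \<in> range_space S \<nu>"
  then obtain f' g' where fg': "(f', g') \<in> S" "y = g' - \<nu> *\<^sub>C f'"
    by (auto simp: range_space_iff)
  show "x + y \<in> range_space S \<nu>"
    unfolding range_space_iff
    by (intro exI[of _ "f + f'"] exI[of _ "g + g'"] conjI linear_operatorD(2)[OF linear_op fg(1) fg'(1)])
      (simp add: fg(2) fg'(2) scaleC_algebra)
qed

text \<open>Since \<open>cinner g f\<close> is real, g - (Re \<nu>) f and i (Im \<nu>) f are
  orthogonal in the real inner product, and Pythagoras applies to their difference.\<close>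

lemma norm_range_space_ge:
  assumes "(f, g) \<in> S"
  shows "\<bar>Im \<nu>\<bar> * norm f \<le> norm (g - \<nu> *\<^sub>C f)"
proof -
  let ?a = "complex_of_real (Re \<nu>)" and ?b = "\<i> * complex_of_real (Im \<nu>)"
  have "Re (cinner (g - ?a *\<^sub>C f) (- (?b *\<^sub>C f))) = 0"
    by (simp add: cinner_minus_right cinner_diff_left cinner_scaleC_left cinner_scaleC_right
        cinner_self symmetric_quadratic_form[OF assms])
  then have "(norm (g - ?a *\<^sub>C f + - (?b *\<^sub>C f)))\<^sup>2 = (norm (g - ?a *\<^sub>C f))\<^sup>2 + (norm (- (?b *\<^sub>C f)))\<^sup>2"
    unfolding inner_eq_Re_cinner[symmetric]
    by (simp only: power2_norm_eq_inner inner_add_left inner_add_right inner_commute)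
  moreover have "g - ?a *\<^sub>C f + - (?b *\<^sub>C f) = g - (?a + ?b) *\<^sub>C f"
    by (simp add: scaleC_add_left)
  moreover have "?a + ?b = \<nu>"
    by (simp flip: complex_eq)
  ultimately have "(norm (?b *\<^sub>C f))\<^sup>2 \<le> (norm (g - \<nu> *\<^sub>C f))\<^sup>2"
    by (metis norm_minus_cancel le_add_same_cancel2 zero_le_power2)
  then have "norm (?b *\<^sub>C f) \<le> norm (g - \<nu> *\<^sub>C f)"
    by (rule power2_le_imp_le) simp
  then show ?thesis
    by (simp add: norm_scaleC norm_mult)
qed

text \<open>If g_n - \<nu> f_n converges, the preceding lower bound makes f_n Cauchy. Then g_n
  converges too, and closedness of the graph puts the limit pair in \<open>S\<close>.\<close>

lemma closed_range_space:
  assumes "Im \<nu> \<noteq> 0"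
  shows "closed (range_space S \<nu>)"
  unfolding closed_sequential_limits
proof (intro allI impI, elim conjE)
  fix X x assume X: "\<forall>n. X n \<in> range_space S \<nu>" and lim: "X \<longlonglongrightarrow> x"
  then obtain f g where S: "\<And>n. (f n, g n) \<in> S" and Xeq: "\<And>n. X n = g n - \<nu> *\<^sub>C f n"
    unfolding range_space_iff by metis
  have "Cauchy f"
  proof (rule metric_CauchyI)
    fix e :: real assume "e > 0"
    then obtain N where N: "\<And>m n. m \<ge> N \<Longrightarrow> n \<ge> N \<Longrightarrow> dist (X m) (X n) < \<bar>Im \<nu>\<bar> * e"
      using metric_CauchyD[OF LIMSEQ_imp_Cauchy[OF lim], of "\<bar>Im \<nu>\<bar> * e"] assms by auto
    have "dist (f m) (f n) < e" if "m \<ge> N" "n \<ge> N" for m n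
    proof -
      have "\<bar>Im \<nu>\<bar> * dist (f m) (f n) \<le> dist (X m) (X n)"
        using norm_range_space_ge[OF linear_operatorD(3)[OF linear_op S[of m] S[of n]], of \<nu>]
        by (simp add: dist_norm Xeq scaleC_diff_right algebra_simps)
      then have "\<bar>Im \<nu>\<bar> * dist (f m) (f n) < \<bar>Im \<nu>\<bar> * e"
        using N[OF that] by linarith
      then show ?thesis using assms by simp
    qed
    then show "\<exists>M. \<forall>m\<ge>M. \<forall>n\<ge>M. dist (f m) (f n) < e" by blast
  qed
  then obtain f0 where f0: "f \<longlonglongrightarrow> f0"
    using Cauchy_convergent convergent_def by blast
  have "(\<lambda>n. X n + \<nu> *\<^sub>C f n) \<longlonglongrightarrow> x + \<nu> *\<^sub>C f0"
    by (intro tendsto_add lim tendsto_scaleC tendsto_const f0)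
  then have "g \<longlonglongrightarrow> x + \<nu> *\<^sub>C f0"
    by (simp add: Xeq)
  then have "(\<lambda>n. (f n, g n)) \<longlonglongrightarrow> (f0, x + \<nu> *\<^sub>C f0)"
    by (intro tendsto_Pair f0)
  moreover have "closed S"
    using closed_sym by (simp add: closed_symmetric_operator_def)
  ultimately have "(f0, x + \<nu> *\<^sub>C f0) \<in> S"
    using S by (rule closed_sequentially[rotated 2])
  then show "x \<in> range_space S \<nu>"
    unfolding range_space_iff
    by (intro exI[of _ f0] exI[of _ "x + \<nu> *\<^sub>C f0"]) simp
qed

end


section \<open>The Cayley transform of a closed symmetric operator\<close>

locale symmetric_cayley =
  fixes S :: "('a::complex_hilbert \<times> 'a) set" and \<mu> :: complex
  assumes closed_sym: "closed_symmetric_operator S" and Im_pos: "Im \<mu> > 0"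
begin

abbreviation M where "M \<equiv> range_space S (cnj \<mu>)"
abbreviation M' where "M' \<equiv> range_space S \<mu>"
abbreviation N where "N \<equiv> defect_space S \<mu>"
abbreviation N' where "N' \<equiv> defect_space S (cnj \<mu>)"

abbreviation W where "W \<equiv> cayley S \<mu>"

lemmas S_linear = linear_operatorD[OF linear_op[OF closed_sym]]

lemma cnj_ne: "\<mu> - cnj \<mu> \<noteq> 0"
  using Im_pos by (auto simp: complex_eq_iff)

lemma W_iff: "(a, b) \<in> W \<longleftrightarrow> (\<exists>f g. (f, g) \<in> S \<and> a = g - cnj \<mu> *\<^sub>C f \<and> b = g - \<mu> *\<^sub>C f)"
  using linear_op[OF closed_sym] by (intro cayley_iff) (simp add: linear_operator_def)

lemma
  shows subspace_M: "complex_vector.subspace M" and subspace_M': "complex_vector.subspace M'"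
    and closed_M: "closed M" and closed_M': "closed M'"
  using Im_pos by (auto intro!: subspace_range_space closed_range_space closed_sym)

lemma N_eq: "N = ortho_compl M" and N'_eq: "N' = ortho_compl M'"
  by (simp_all add: defect_space_def)

lemmas proj_M = proj_in[OF subspace_M closed_M] and proj_M' = proj_in[OF subspace_M' closed_M']
lemmas diff_proj_M = diff_proj_in[OF subspace_M closed_M]
  and diff_proj_M' = diff_proj_in[OF subspace_M' closed_M']
lemmas hom_proj_M = proj_module_hom[OF subspace_M closed_M]
  and hom_proj_M' = proj_module_hom[OF subspace_M' closed_M']

lemma proj_N: "proj N x = x - proj M x" and proj_N': "proj N' x = x - proj M' x"
  unfolding N_eq N'_eq by (intro proj_ortho_compl subspace_M subspace_M' closed_M closed_M')+

lemma subspace_N: "complex_vector.subspace N" and subspace_N': "complex_vector.subspace N'"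
  by (simp_all add: N_eq N'_eq subspace_ortho_compl)

lemma hom_proj_N': "module_hom scaleC scaleC (proj N')"
  unfolding proj_N'[abs_def]
  by (simp add: module_hom_iff complex_vector.module_axioms module_hom.add[OF hom_proj_M']
      module_hom.scale[OF hom_proj_M'] scaleC_diff_right)

lemma proj_N'_in: "proj N' x \<in> N'"
  unfolding proj_N' unfolding N'_eq by (rule diff_proj_M')

lemma norm_proj_N'_le: "norm (proj N' x) \<le> norm x"
  by (rule power2_le_imp_le)
    (use norm_proj_Pythagoras[OF subspace_M' closed_M', of x] in \<open>auto simp: proj_N'\<close>)

lemma W_range: "(a, b) \<in> W \<Longrightarrow> a \<in> M" "(a, b) \<in> W \<Longrightarrow> b \<in> M'"
  by (auto simp: W_iff range_space_iff)

lemma W_Domain: "a \<in> M \<Longrightarrow> \<exists>b. (a, b) \<in> W" and W_Range: "b \<in> M' \<Longrightarrow> \<exists>a. (a, b) \<in> W"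
  unfolding W_iff range_space_iff by blast+

section \<open>The Cayley transform as a linear isometry\<close>

text \<open>Expanding both sides, the mixed terms carry the coefficients \<open>\<mu>\<close> and
  \<open>cnj \<mu>\<close> in exchanged places; they agree by symmetry of \<open>S\<close>.\<close>

lemma W_cinner: "(a, b) \<in> W \<Longrightarrow> (c, d) \<in> W \<Longrightarrow> cinner a c = cinner b d"
proof -
  assume "(a, b) \<in> W" "(c, d) \<in> W"
  then obtain f g f' g' where fg: "(f, g) \<in> S" "a = g - cnj \<mu> *\<^sub>C f" "b = g - \<mu> *\<^sub>C f"
    "(f', g') \<in> S" "c = g' - cnj \<mu> *\<^sub>C f'" "d = g' - \<mu> *\<^sub>C f'"
    unfolding W_iff by metis
  have "cinner g f' = cinner f g'"
    using symmetric_cinner[OF closed_sym fg(1,4)] .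
  then show ?thesis
    unfolding fg(2,3,5,6)
    by (simp add: cinner_diff_left cinner_diff_right cinner_scaleC_left cinner_scaleC_right algebra_simps)
qed

lemma W_norm: "(a, b) \<in> W \<Longrightarrow> norm a = norm b"
  by (rule norm_eq_if_cinner_eq) (simp add: W_cinner)

lemma W_add: "(a, b) \<in> W \<Longrightarrow> (c, d) \<in> W \<Longrightarrow> (a + c, b + d) \<in> W"
proof -
  assume "(a, b) \<in> W" "(c, d) \<in> W"
  then obtain f g f' g' where "(f, g) \<in> S" "a = g - cnj \<mu> *\<^sub>C f" "b = g - \<mu> *\<^sub>C f"
    "(f', g') \<in> S" "c = g' - cnj \<mu> *\<^sub>C f'" "d = g' - \<mu> *\<^sub>C f'"
    by (auto simp: W_iff)
  then show ?thesis
    unfolding W_iff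
    by (intro exI[of _ "f + f'"] exI[of _ "g + g'"] conjI S_linear(2)) (simp_all add: scaleC_algebra)
qed

lemma W_scale: "(a, b) \<in> W \<Longrightarrow> (c *\<^sub>C a, c *\<^sub>C b) \<in> W"
proof -
  assume "(a, b) \<in> W"
  then obtain f g where "(f, g) \<in> S" "a = g - cnj \<mu> *\<^sub>C f" "b = g - \<mu> *\<^sub>C f"
    by (auto simp: W_iff)
  then show ?thesis
    unfolding W_iff
    by (intro exI[of _ "c *\<^sub>C f"] exI[of _ "c *\<^sub>C g"] conjI S_linear(4))
      (simp_all add: scaleC_algebra mult.commute)
qed

lemma W_diff: "(a, b) \<in> W \<Longrightarrow> (c, d) \<in> W \<Longrightarrow> (a - c, b - d) \<in> W"
  using W_add[of a b "- c" "- d"] W_scale[of c d "- 1"] by (simp add: scaleC_minus_left scaleC_one)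

text \<open>The difference of two such pairs is (0, b - b'), and the isometry gives b - b' norm
  zero. Injectivity follows in the same way.\<close>

lemma W_single_valued: "(a, b) \<in> W \<Longrightarrow> (a, b') \<in> W \<Longrightarrow> b = b'"
  using W_norm[OF W_diff] by fastforce

lemma W_injective: "(a, b) \<in> W \<Longrightarrow> (a', b) \<in> W \<Longrightarrow> a = a'"
  using W_norm[OF W_diff] by fastforce

text \<open>Equality of the two components cancels g and leaves a nonzero multiple of f, so f = 0.
  Then g = 0 because \<open>S\<close> is single-valued.\<close>

lemma W_fixed: "(a, a) \<in> W \<Longrightarrow> a = 0"
proof -
  assume "(a, a) \<in> W"
  then obtain f g where fg: "(f, g) \<in> S" "a = g - cnj \<mu> *\<^sub>C f" "a = g - \<mu> *\<^sub>C f"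
    by (auto simp: W_iff)
  then have "(\<mu> - cnj \<mu>) *\<^sub>C f = 0"
    by (simp add: scaleC_diff_left)
  then have "f = 0"
    using cnj_ne by (simp add: complex_vector.scale_eq_0_iff)
  then show ?thesis
    using fg S_linear(1,5) by force
qed

section \<open>The adjoint contraction and the density of ran (I - A)\<close>

definition A :: "'a \<Rightarrow> 'a" where "A h = (THE a. (a, proj M' h) \<in> W)"

lemma A_in_W: "(A h, proj M' h) \<in> W"
  unfolding A_def using W_Range[OF proj_M'] W_injective by (metis (mono_tags, lifting) theI)

lemma A_eqI: "(a, proj M' h) \<in> W \<Longrightarrow> A h = a"
  using A_in_W W_injective by blast

lemma A_in_M: "A h \<in> M"
  using A_in_W W_range by blast

lemma hom_A: "module_hom scaleC scaleC A"
  unfolding module_hom_iff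
  by (intro conjI allI complex_vector.module_axioms A_eqI)
    (simp_all add: module_hom.add[OF hom_proj_M'] module_hom.scale[OF hom_proj_M'] W_add W_scale A_in_W)

lemma norm_A_le: "norm (A h) \<le> norm h"
  using W_norm[OF A_in_W] norm_proj_le[OF subspace_M' closed_M'] by metis

lemma cinner_eq_proj_M: "c \<in> M \<Longrightarrow> cinner x c = cinner (proj M x) c"
  using ortho_complD[OF diff_proj_M, of c x] by (simp add: cinner_diff_left)

lemma cinner_eq_proj_M': "c \<in> M' \<Longrightarrow> cinner x c = cinner (proj M' x) c"
  using ortho_complD[OF diff_proj_M', of c x] by (simp add: cinner_diff_left)

text \<open>The isometry moves the product to the range side, and \<open>b\<close> in
  \<open>M'\<close> allows the projection onto \<open>M'\<close> to be dropped. This is the adjoint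
  relation in the form used throughout.\<close>

lemma cinner_A: "(a, b) \<in> W \<Longrightarrow> cinner (A h) a = cinner h b"
  using W_cinner[OF A_in_W[of h], of a b] cinner_eq_proj_M'[OF W_range(2), of a b h] by simp

text \<open>A vector x orthogonal to ran (I - A) satisfies x = W P_M x. As W preserves norms, P_M x
  is as long as x, so x lies in \<open>M\<close> and is a fixed vector of W, hence zero.\<close>

lemma dense_range_A: "closure (range (\<lambda>x. x - A x)) = UNIV"
proof (rule dense_if_ortho_compl_trivial)
  show "complex_vector.subspace (range (\<lambda>x. x - A x))"
    by (rule module_hom_subspace_range_diff[OF hom_A])
  show "ortho_compl (range (\<lambda>x. x - A x)) \<subseteq> {0}"
  proof
    fix x assume "x \<in> ortho_compl (range (\<lambda>x. x - A x))"
    then have orth: "cinner h x = cinner (A h) x" for h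
      using ortho_complD'[of x "range (\<lambda>x. x - A x)" "h - A h"] by (auto simp: cinner_diff_left)
    obtain b where b: "(proj M x, b) \<in> W"
      using W_Domain[OF proj_M] by blast
    have "cinner h x = cinner h b" for h
    proof -
      have "cinner h x = cnj (cinner x (A h))"
        using orth[of h] cinner_commute by metis
      also have "\<dots> = cinner (A h) (proj M x)"
        using cinner_eq_proj_M[OF A_in_M] cinner_commute by metis
      finally show ?thesis
        using cinner_A[OF b] by simp
    qed
    then have "cinner (x - b) (x - b) = 0"
      by (simp add: cinner_diff_right)
    then have "x = b" by simp
    then have "norm (proj M x) = norm x"
      using W_norm[OF b] by simp
    then have "x = proj M x"
      using norm_proj_Pythagoras[OF subspace_M closed_M, of x] by simp
    then show "x \<in> {0}"
      using W_fixed b \<open>x = b\<close> by auto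
  qed
qed

section \<open>Cayley transforms of Shtraus extensions\<close>

text \<open>The point is that dom S meets the defect space at z only in 0. For u in both, with image
  v under \<open>S\<close>, orthogonality gives (u, v) = z (u, u); the left side is real and Im z >
  0, so u = 0.\<close>

lemma single_valued_shtraus:
  assumes "Im z > 0"
  shows "single_valued (shtraus S z)"
proof (rule single_valuedI)
  fix x y y' assume "(x, y) \<in> shtraus S z" "(x, y') \<in> shtraus S z"
  then obtain f g \<phi> f' g' \<phi>' where *: "(f, g) \<in> S" "\<phi> \<in> defect_space S z" "x = f + \<phi>"
     "y = g + z *\<^sub>C \<phi>" "(f', g') \<in> S" "\<phi>' \<in> defect_space S z" "x = f' + \<phi>'" "y' = g' + z *\<^sub>C \<phi>'"
    by (auto simp: shtraus_def)
  define u v where "u = f - f'" and "v = g - g'"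
  have uv: "(u, v) \<in> S"
    using * S_linear(3) by (simp add: u_def v_def)
  have "\<phi>' - \<phi> \<in> defect_space S z"
    using * by (auto simp: defect_space_def intro: complex_vector.subspace_diff subspace_ortho_compl)
  moreover have u: "\<phi>' - \<phi> = u"
    using *(3,7) by (simp add: u_def algebra_simps)
  moreover have "v - cnj z *\<^sub>C u \<in> range_space S (cnj z)"
    using uv by (auto simp only: range_space_iff)
  ultimately have "cinner u (v - cnj z *\<^sub>C u) = 0"
    unfolding defect_space_def by (metis ortho_complD)
  then have "cinner u v = z * cinner u u"
    by (simp add: cinner_diff_right cinner_scaleC_right)
  moreover have "Im (cinner u v) = 0"
    using symmetric_quadratic_form[OF closed_sym uv] by (subst cinner_commute) simp
  ultimately have "u = 0"
    using assms by (simp add: cinner_self)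
  then have "v = 0"
    using uv S_linear(1,5) by blast
  then show "y = y'"
    using * u \<open>u = 0\<close> by (simp add: v_def)
qed

text \<open>The substitution \<open>\<psi> = (z - cnj \<mu>) \<phi>\<close> turns the condition \<open>\<phi> \<in> defect_space S z\<close> into one
  on \<open>\<psi>\<close> which involves only the Cayley transform of \<open>S\<close> and the number \<open>w\<close>.\<close>

lemma cayley_shtraus_iff:
  assumes z: "Im z > 0"
  defines "w \<equiv> (z - \<mu>) / (z - cnj \<mu>)"
  shows "(x, y) \<in> cayley (shtraus S z) \<mu> \<longleftrightarrow>
    (\<exists>a b \<psi>. (a, b) \<in> W \<and> \<psi> - w *\<^sub>C A \<psi> \<in> N \<and> x = a + \<psi> \<and> y = b + w *\<^sub>C \<psi>)"
    (is "?L \<longleftrightarrow> ?R")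
proof -
  have ne: "z - cnj \<mu> \<noteq> 0" using z Im_pos by (auto simp: complex_eq_iff)
  have defect: "\<phi> \<in> defect_space S z \<longleftrightarrow> (z - cnj \<mu>) *\<^sub>C \<phi> - w *\<^sub>C A ((z - cnj \<mu>) *\<^sub>C \<phi>) \<in> N" for \<phi>
  proof -
    let ?\<psi> = "(z - cnj \<mu>) *\<^sub>C \<phi>"
    \<comment> \<open>Since \<mu> - cnj \<mu> is nonzero, the two orthogonality conditions are
      equivalent for each pair (f, g) separately.\<close>
    have *: "cinner (?\<psi> - w *\<^sub>C A ?\<psi>) (g - cnj \<mu> *\<^sub>C f) = (\<mu> - cnj \<mu>) * cinner \<phi> (g - cnj z *\<^sub>C f)"
      if "(f, g) \<in> S" for f g
    proof -
      have "(g - cnj \<mu> *\<^sub>C f, g - \<mu> *\<^sub>C f) \<in> W"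
        using that by (auto simp: W_iff)
      then have "cinner (A ?\<psi>) (g - cnj \<mu> *\<^sub>C f) = cinner ?\<psi> (g - \<mu> *\<^sub>C f)"
        by (rule cinner_A)
      then have eq: "cinner (w *\<^sub>C A ?\<psi>) (g - cnj \<mu> *\<^sub>C f) = (z - \<mu>) * cinner \<phi> (g - \<mu> *\<^sub>C f)"
        using ne by (simp add: cinner_scaleC_left w_def)
      show ?thesis
        unfolding cinner_diff_left[of ?\<psi> "w *\<^sub>C A ?\<psi>"] eq
        unfolding cinner_diff_right cinner_scaleC_left cinner_scaleC_right
        by (simp add: algebra_simps)
    qed
    show ?thesis
      unfolding defect_space_iff using * cnj_ne by simp
  qed
  have "?L \<longleftrightarrow> (\<exists>f g \<phi>. (f, g) \<in> S \<and> \<phi> \<in> defect_space S z \<and>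
      x = (g + z *\<^sub>C \<phi>) - cnj \<mu> *\<^sub>C (f + \<phi>) \<and> y = (g + z *\<^sub>C \<phi>) - \<mu> *\<^sub>C (f + \<phi>))"
    unfolding cayley_iff[OF single_valued_shtraus[OF z]] shtraus_iff by blast
  also have "\<dots> \<longleftrightarrow> (\<exists>f g \<phi>. (f, g) \<in> S \<and> \<phi> \<in> defect_space S z \<and>
      x = (g - cnj \<mu> *\<^sub>C f) + (z - cnj \<mu>) *\<^sub>C \<phi> \<and> y = (g - \<mu> *\<^sub>C f) + (z - \<mu>) *\<^sub>C \<phi>)"
  proof -
    have "(g + z *\<^sub>C \<phi>) - c *\<^sub>C (f + \<phi>) = (g - c *\<^sub>C f) + (z - c) *\<^sub>C \<phi>" for c f g and \<phi> :: 'a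
      by (simp add: scaleC_algebra)
    then show ?thesis by (simp only:)
  qed
  also have "\<dots> \<longleftrightarrow> (\<exists>a b \<phi>. (a, b) \<in> W \<and> \<phi> \<in> defect_space S z \<and>
      x = a + (z - cnj \<mu>) *\<^sub>C \<phi> \<and> y = b + w *\<^sub>C (z - cnj \<mu>) *\<^sub>C \<phi>)"
  proof -
    have *: "w *\<^sub>C (z - cnj \<mu>) *\<^sub>C \<phi> = (z - \<mu>) *\<^sub>C \<phi>" for \<phi> :: 'a
      using ne by (simp add: w_def scaleC_scaleC)
    show ?thesis
      unfolding W_iff * by blast
  qed
  also have "\<dots> \<longleftrightarrow> ?R"
  proof
    assume ?R
    then obtain a b \<psi> where *: "(a, b) \<in> W" "\<psi> - w *\<^sub>C A \<psi> \<in> N" "x = a + \<psi>" "y = b + w *\<^sub>C \<psi>"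
      by blast
    have "(z - cnj \<mu>) *\<^sub>C (1 / (z - cnj \<mu>)) *\<^sub>C \<psi> = \<psi>"
      using ne by (simp add: scaleC_scaleC scaleC_one)
    with * show "\<exists>a b \<phi>. (a, b) \<in> W \<and> \<phi> \<in> defect_space S z \<and>
        x = a + (z - cnj \<mu>) *\<^sub>C \<phi> \<and> y = b + w *\<^sub>C (z - cnj \<mu>) *\<^sub>C \<phi>"
      unfolding defect by metis
  qed (use defect in blast)
  finally show ?thesis .
qed

text \<open>For z = \<mu> the number w is 0, so \<psi> ranges over \<open>N\<close> and no longer
  affects the second component; a is then the projection of x onto \<open>M\<close>.\<close>

lemma cayley_shtraus_self_iff: "(x, y) \<in> cayley (shtraus S \<mu>) \<mu> \<longleftrightarrow> (proj M x, y) \<in> W"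
proof -
  have "(x, y) \<in> cayley (shtraus S \<mu>) \<mu> \<longleftrightarrow> (\<exists>a \<psi>. (a, y) \<in> W \<and> \<psi> \<in> N \<and> x = a + \<psi>)"
    unfolding cayley_shtraus_iff[OF Im_pos] by auto
  also have "\<dots> \<longleftrightarrow> (proj M x, y) \<in> W"
  proof
    assume "\<exists>a \<psi>. (a, y) \<in> W \<and> \<psi> \<in> N \<and> x = a + \<psi>"
    then obtain a \<psi> where *: "(a, y) \<in> W" "\<psi> \<in> N" "x = a + \<psi>" by blast
    then have "proj M x = a"
      by (intro proj_eqI subspace_M) (auto simp: N_eq W_range)
    with * show "(proj M x, y) \<in> W" by simp
  next
    assume "(proj M x, y) \<in> W"
    then show "\<exists>a \<psi>. (a, y) \<in> W \<and> \<psi> \<in> N \<and> x = a + \<psi>"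
      using diff_proj_M[of x] by (intro exI[of _ "proj M x"] exI[of _ "x - proj M x"]) (simp add: N_eq)
  qed
  finally show ?thesis .
qed

lemma adjoint_cayley_shtraus: "op_adjoint (cayley (shtraus S \<mu>) \<mu>) = op_of A"
proof -
  have eq: "cinner y h = cinner x (A h)" if "(proj M x, y) \<in> W" for x y h
  proof -
    have "cinner h y = cinner (A h) (proj M x)"
      using cinner_A[OF that] by simp
    then have "cinner y h = cinner (proj M x) (A h)"
      by (metis cinner_commute)
    then show ?thesis
      using cinner_eq_proj_M[OF A_in_M, of x h] by simp
  qed
  have "(\<forall>(x, y)\<in>cayley (shtraus S \<mu>) \<mu>. cinner y h = cinner x k) \<longleftrightarrow> k = A h" for h k
  proof
    assume *: "\<forall>(x, y)\<in>cayley (shtraus S \<mu>) \<mu>. cinner y h = cinner x k"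
    \<comment> \<open>The Cayley transform is defined everywhere, so the adjoint condition may be
      tested at the vector \<open>k - A h\<close> itself.\<close>
    obtain y where y: "(proj M (k - A h), y) \<in> W"
      using W_Domain[OF proj_M] by blast
    then have "cinner y h = cinner (k - A h) k"
      using * by (auto simp: cayley_shtraus_self_iff)
    then have "cinner (k - A h) (k - A h) = 0"
      using eq[OF y, of h] by (simp add: cinner_diff_right)
    then show "k = A h" by simp
  qed (auto simp: cayley_shtraus_self_iff eq)
  then show ?thesis
    by (auto simp: op_adjoint_def op_of_def)
qed

section \<open>The characteristic function through the resolvent of A\<close>

text \<open>For x in \<open>N\<close>, the vector a + wA\<psi> lies in \<open>N\<close> as a
  difference of two elements of \<open>N\<close>, and in \<open>M\<close> because both summands do.
  So it vanishes, which determines b = -w P_M' \<psi> and leaves y = w(I - P_M')\<psi>.\<close>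

lemma char_fun_iff:
  assumes z: "Im z > 0"
  defines "w \<equiv> (z - \<mu>) / (z - cnj \<mu>)"
  shows "(x, y) \<in> char_fun S \<mu> z \<longleftrightarrow> x \<in> N \<and> (\<exists>\<psi>. x = \<psi> - w *\<^sub>C A \<psi> \<and> y = w *\<^sub>C proj N' \<psi>)"
proof -
  have "(\<exists>a b \<psi>. (a, b) \<in> W \<and> \<psi> - w *\<^sub>C A \<psi> \<in> N \<and> x = a + \<psi> \<and> y = b + w *\<^sub>C \<psi>) \<longleftrightarrow>
      (\<exists>\<psi>. x = \<psi> - w *\<^sub>C A \<psi> \<and> y = w *\<^sub>C proj N' \<psi>)" (is "?L \<longleftrightarrow> ?R") if x: "x \<in> N"
  proof
    assume ?L
    then obtain a b \<psi> where *: "(a, b) \<in> W" "\<psi> - w *\<^sub>C A \<psi> \<in> N" "x = a + \<psi>" "y = b + w *\<^sub>C \<psi>"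
      by blast
    have eq: "a + w *\<^sub>C A \<psi> = x - (\<psi> - w *\<^sub>C A \<psi>)"
      using *(3) by simp
    have "a + w *\<^sub>C A \<psi> \<in> N"
      unfolding eq by (rule complex_vector.subspace_diff[OF subspace_N x *(2)])
    moreover have "a + w *\<^sub>C A \<psi> \<in> M"
      using W_range(1)[OF *(1)] A_in_M[of \<psi>]
      by (intro complex_vector.subspace_add complex_vector.subspace_scale subspace_M)
    ultimately have "a + w *\<^sub>C A \<psi> = 0"
      unfolding N_eq by (rule subspace_ortho_compl_Int[rotated])
    then have a: "a = (- w) *\<^sub>C A \<psi>"
      by (simp add: scaleC_minus_left eq_neg_iff_add_eq_0)
    then have "b = (- w) *\<^sub>C proj M' \<psi>"
      using W_single_valued[OF *(1)] W_scale[OF A_in_W] by blast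
    with * a show ?R
      by (intro exI[of _ \<psi>]) (simp add: proj_N' scaleC_algebra)
  next
    assume ?R
    then obtain \<psi> where "x = \<psi> - w *\<^sub>C A \<psi>" "y = w *\<^sub>C proj N' \<psi>" by blast
    then show ?L
      using x W_scale[OF A_in_W, of "- w" \<psi>]
      by (intro exI[of _ "(- w) *\<^sub>C A \<psi>"] exI[of _ "(- w) *\<^sub>C proj M' \<psi>"] exI[of _ \<psi>])
        (simp add: proj_N' scaleC_algebra)
  qed
  then show ?thesis
    using cayley_shtraus_iff[OF z, of x y] by (auto simp: char_fun_def op_restrict_def w_def)
qed

section \<open>Vectors orthogonal to the domain and the non-tangential limit\<close>

text \<open>The difference a - b is a multiple of a vector f in dom S, to which h is
  orthogonal.\<close>

lemma dom_defect_cinner: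
  "h \<in> dom_defect S \<Longrightarrow> (a, b) \<in> W \<Longrightarrow> cinner h a = cinner h b"
proof -
  assume h: "h \<in> dom_defect S" and "(a, b) \<in> W"
  then obtain f g where fg: "(f, g) \<in> S" "a = g - cnj \<mu> *\<^sub>C f" "b = g - \<mu> *\<^sub>C f"
    by (auto simp: W_iff)
  have "f \<in> closure (Domain S)"
    by (meson DomainI closure_subset fg(1) subsetD)
  then have "cinner h f = 0"
    using h by (auto simp: dom_defect_def intro: ortho_complD)
  with fg show ?thesis
    by (simp add: cinner_diff_right cinner_scaleC_right)
qed

text \<open>Both vectors lie in \<open>M\<close> and have the same inner product with every a in
  \<open>M\<close>, namely (h, Wa) = (h, a). Testing on their difference gives equality.\<close>

lemma A_eq_proj_M:
  assumes "h \<in> dom_defect S"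
  shows "A h = proj M h"
proof -
  have "proj M h - A h \<in> M"
    by (intro complex_vector.subspace_diff subspace_M proj_M A_in_M)
  then obtain b where b: "(proj M h - A h, b) \<in> W"
    using W_Domain by blast
  have "cinner (proj M h) (proj M h - A h) = cinner (A h) (proj M h - A h)"
    using cinner_eq_proj_M[OF W_range(1)[OF b], of h] dom_defect_cinner[OF assms b] cinner_A[OF b]
    by simp
  then have "cinner (proj M h - A h) (proj M h - A h) = 0"
    by (simp add: cinner_diff_left)
  then show ?thesis by simp
qed

text \<open>What has to be shown is that the value is independent of h. If h and k have equal
  projections onto \<open>N\<close>, then d = h - k lies in \<open>M\<close>, and (d, P_M' d)
  belongs to \<open>W\<close>. Equality of norms forces d into \<open>M'\<close>, so its projection
  onto \<open>N'\<close> vanishes.\<close>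

lemma V_op_app:
  assumes "h \<in> dom_defect S"
  shows "op_app (V_op S \<mu>) (proj N h) = proj N' h"
  unfolding op_app_def
proof (rule the_equality)
  show "(proj N h, proj N' h) \<in> V_op S \<mu>"
    using assms by (auto simp: V_op_def)
  fix y assume "(proj N h, y) \<in> V_op S \<mu>"
  then obtain k where k: "k \<in> dom_defect S" "proj N h = proj N k" "y = proj N' k"
    by (auto simp: V_op_def)
  let ?d = "h - k"
  have "?d \<in> dom_defect S"
    using assms k by (auto simp: dom_defect_def intro: complex_vector.subspace_diff subspace_ortho_compl)
  then have "(proj M ?d, proj M' ?d) \<in> W"
    using A_in_W A_eq_proj_M by metis
  then have "norm (proj M ?d) = norm (proj M' ?d)"
    by (rule W_norm)
  moreover have "proj M ?d = ?d"
    using k(2) by (simp add: proj_N module_hom.diff[OF hom_proj_M] algebra_simps)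
  ultimately have "?d - proj M' ?d = 0"
    using norm_proj_Pythagoras[OF subspace_M' closed_M', of ?d] by simp
  then show "y = proj N' h"
    unfolding k(3) by (simp add: proj_N' module_hom.diff[OF hom_proj_M'] algebra_simps)
qed

lemma nontangential_limit_char_fun:
  assumes h: "h \<in> dom_defect S"
  shows "nontangential_limit_at_infinity (\<lambda>z. op_app (char_fun S \<mu> z) (proj N h)) (proj N' h)"
  unfolding nontangential_limit_at_infinity_def
proof (intro allI impI, elim conjE)
  fix \<delta> :: real assume \<delta>: "0 < \<delta>" "\<delta> < pi / 2"
  define F where "F = inf at_infinity (principal {z. \<delta> < Arg z \<and> Arg z < pi - \<delta>})"
  define w where "w z = (z - \<mu>) / (z - cnj \<mu>)" for z
  \<comment> \<open>This is (I - wA)^{-1} A h. Outside the upper half-plane the choice may be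
    arbitrary, which the limit does not see.\<close>
  define p where "p z = (SOME p. p - w z *\<^sub>C A p = A h)" for z
  have "sin \<delta> > 0"
    using \<delta> by (intro sin_gt_zero) auto
  have "\<forall>\<^sub>F z in at_infinity. cmod \<mu> + 1 \<le> cmod z"
    by (auto simp: eventually_at_infinity)
  \<comment> \<open>The bound on |z| serves twice: it gives |\<mu>| \<le> |z| for the Stolz
    estimate, and |z| > 0, which makes Im z positive.\<close>
  then have sector: "\<forall>\<^sub>F z in F. cmod \<mu> + 1 \<le> cmod z \<and> cmod z * sin \<delta> \<le> Im z"
    unfolding F_def eventually_inf_principal
    by eventually_elim (use sin_le_in_sector \<delta> in auto)
  then have Im: "\<forall>\<^sub>F z in F. Im z > 0"
  proof eventually_elim
    case (elim z)
    then have "cmod z > 0"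
      using norm_ge_zero[of \<mu>] by linarith
    then have "cmod z * sin \<delta> > 0"
      using \<open>sin \<delta> > 0\<close> by simp
    with elim show ?case by linarith
  qed
  have w1: "(w \<longlongrightarrow> 1) F"
    unfolding F_def w_def[abs_def] by (rule tendsto_mono[OF inf_le1 tendsto_Moebius_at_infinity])
  have p: "p z - w z *\<^sub>C A (p z) = A h" if "Im z > 0" for z
    unfolding p_def
    by (rule someI_ex, rule resolvent_exists[OF hom_A norm_A_le])
      (use cmod_Moebius_less_1[OF Im_pos that] in \<open>simp add: w_def\<close>)
  have "((\<lambda>z. (1 - w z) *\<^sub>C p z) \<longlongrightarrow> 0) F"
  proof (rule tendsto_resolvent_Stolz[OF hom_A norm_A_le dense_range_A w1])
    show "\<forall>\<^sub>F z in F. cmod (1 - w z) \<le> 2 / sin \<delta> * (1 - cmod (w z))"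
      using sector Im unfolding w_def
      by eventually_elim (intro cmod_Moebius_Stolz Im_pos \<open>sin \<delta> > 0\<close>, auto)
    show "\<forall>\<^sub>F z in F. p z - w z *\<^sub>C A (p z) = A h"
      using Im by eventually_elim (rule p)
  qed (use \<open>sin \<delta> > 0\<close> in simp)
  then have "((\<lambda>z. norm ((1 - w z) *\<^sub>C p z)) \<longlongrightarrow> 0) F"
    by (rule tendsto_norm_zero)
  then have "((\<lambda>z. proj N' ((1 - w z) *\<^sub>C p z)) \<longlongrightarrow> 0) F"
    by (rule Lim_null_comparison[rotated]) (simp add: norm_proj_N'_le)
  then have "((\<lambda>z. w z *\<^sub>C (proj N' h - proj N' ((1 - w z) *\<^sub>C p z))) \<longlongrightarrow> 1 *\<^sub>C (proj N' h - 0)) F"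
    by (intro tendsto_scaleC w1 tendsto_diff tendsto_const)
  moreover have "\<forall>\<^sub>F z in F. op_app (char_fun S \<mu> z) (proj N h) =
      w z *\<^sub>C (proj N' h - proj N' ((1 - w z) *\<^sub>C p z))"
    using Im
  proof eventually_elim
    case (elim z)
    \<comment> \<open>This is (I - wA)^{-1} applied to the projection of h onto \<open>N\<close>:
      applying I - wA leaves h - wAh - (1 - w)Ah = h - Ah, and Ah is the projection of h onto
      \<open>M\<close>.\<close>
    let ?u = "h - (1 - w z) *\<^sub>C p z"
    have "?u - w z *\<^sub>C A ?u = h - w z *\<^sub>C A h - (1 - w z) *\<^sub>C (p z - w z *\<^sub>C A (p z))"
      by (simp add: module_hom.diff[OF hom_A] module_hom.add[OF hom_A] module_hom.scale[OF hom_A]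
          scaleC_algebra algebra_simps)
    then have u: "proj N h = ?u - w z *\<^sub>C A ?u"
      unfolding p[OF elim] by (simp add: proj_N A_eq_proj_M[OF h] scaleC_algebra scaleC_one)
    have N: "proj N h \<in> N"
      unfolding proj_N unfolding N_eq by (rule diff_proj_M)
    have "op_app (char_fun S \<mu> z) (proj N h) = w z *\<^sub>C proj N' ?u"
      unfolding op_app_def
    proof (rule the_equality)
      show "(proj N h, w z *\<^sub>C proj N' ?u) \<in> char_fun S \<mu> z"
        using N u by (auto simp: char_fun_iff[OF elim] w_def)
      fix y assume "(proj N h, y) \<in> char_fun S \<mu> z"
      then obtain v where v: "proj N h = v - w z *\<^sub>C A v" "y = w z *\<^sub>C proj N' v"
        by (auto simp: char_fun_iff[OF elim] w_def)
      have "cmod (w z) < 1"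
        using cmod_Moebius_less_1[OF Im_pos elim] by (simp add: w_def)
      then have "v = ?u"
        by (rule resolvent_unique[OF hom_A norm_A_le]) (metis u v(1))
      then show "y = w z *\<^sub>C proj N' ?u"
        by (simp add: v(2))
    qed
    then show ?case
      by (simp add: module_hom.diff[OF hom_proj_N'])
  qed
  ultimately show "((\<lambda>z. op_app (char_fun S \<mu> z) (proj N h)) \<longlongrightarrow> proj N' h)
      (inf at_infinity (principal {z. \<delta> < Arg z \<and> Arg z < pi - \<delta>}))"
    unfolding F_def[symmetric] by (simp add: tendsto_cong scaleC_one)
qed

section \<open>Identities between graphs and boundedness of the operators\<close>

lemma cayley_shtraus_self:
  "cayley (shtraus S \<mu>) \<mu> =
    (S -\<^sub>o \<mu> \<cdot>\<^sub>o Id) \<circ>\<^sub>o (S -\<^sub>o cnj \<mu> \<cdot>\<^sub>o Id)\<inverse> \<circ>\<^sub>o op_of (proj M)"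
proof -
  have "(x, y) \<in> (S -\<^sub>o \<mu> \<cdot>\<^sub>o Id) \<circ>\<^sub>o (S -\<^sub>o cnj \<mu> \<cdot>\<^sub>o Id)\<inverse> \<circ>\<^sub>o op_of (proj M) \<longleftrightarrow> (proj M x, y) \<in> W"
    for x y
    by (auto simp: cayley_def op_comp_def op_of_def)
  then show ?thesis
    using cayley_shtraus_self_iff by auto
qed

lemma resolvent_adjoint_iff:
  "(x, u) \<in> (Id -\<^sub>o c \<cdot>\<^sub>o op_adjoint (cayley (shtraus S \<mu>) \<mu>))\<inverse> \<longleftrightarrow> x = u - c *\<^sub>C A u"
  unfolding adjoint_cayley_shtraus by (auto simp: op_diff_def op_scale_def op_of_def)

lemma bounded_resolvent_adjoint:
  assumes "Im z > 0"
  shows "bounded_operator_between UNIV UNIV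
    ((Id -\<^sub>o ((z - \<mu>) / (z - cnj \<mu>)) \<cdot>\<^sub>o op_adjoint (cayley (shtraus S \<mu>) \<mu>))\<inverse>)"
proof -
  have "module_hom scaleC scaleC (\<lambda>x::'a. x)"
    by (simp add: module_hom_iff complex_vector.module_axioms)
  then have "bounded_operator_between UNIV UNIV
      {(x, y). x \<in> UNIV \<and> (\<exists>u. x = u - ((z - \<mu>) / (z - cnj \<mu>)) *\<^sub>C A u \<and> y = 1 *\<^sub>C u)}"
    by (intro bounded_operator_between_resolvent hom_A norm_A_le cmod_Moebius_less_1 Im_pos assms)
      (auto simp: complex_vector.subspace_UNIV)
  also have "{(x, y). x \<in> UNIV \<and> (\<exists>u. x = u - ((z - \<mu>) / (z - cnj \<mu>)) *\<^sub>C A u \<and> y = 1 *\<^sub>C u)} =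
      (Id -\<^sub>o ((z - \<mu>) / (z - cnj \<mu>)) \<cdot>\<^sub>o op_adjoint (cayley (shtraus S \<mu>) \<mu>))\<inverse>"
    using resolvent_adjoint_iff by (auto simp: scaleC_one)
  finally show ?thesis .
qed

lemma bounded_char_fun:
  assumes "Im z > 0"
  shows "bounded_operator_between N N' (char_fun S \<mu> z)"
proof -
  have "char_fun S \<mu> z = {(x, y). x \<in> N \<and> (\<exists>u. x = u - ((z - \<mu>) / (z - cnj \<mu>)) *\<^sub>C A u \<and>
      y = ((z - \<mu>) / (z - cnj \<mu>)) *\<^sub>C proj N' u)}"
    using char_fun_iff[OF assms] by auto
  then show ?thesis
    by (simp only:) (intro bounded_operator_between_resolvent hom_A norm_A_le cmod_Moebius_less_1
        Im_pos assms hom_proj_N' norm_proj_N'_le proj_N'_in subspace_N subspace_N')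
qed

lemma char_fun_eq:
  assumes "Im z > 0"
  shows "char_fun S \<mu> z = ((z - \<mu>) / (z - cnj \<mu>)) \<cdot>\<^sub>o (op_of (proj N') \<circ>\<^sub>o
    (Id -\<^sub>o ((z - \<mu>) / (z - cnj \<mu>)) \<cdot>\<^sub>o op_adjoint (cayley (shtraus S \<mu>) \<mu>))\<inverse>) \<restriction>\<^sub>o N"
proof -
  have "(x, y) \<in> c \<cdot>\<^sub>o (op_of (proj N') \<circ>\<^sub>o R) \<restriction>\<^sub>o N \<longleftrightarrow>
      x \<in> N \<and> (\<exists>u. (x, u) \<in> R \<and> y = c *\<^sub>C proj N' u)" for x y c R
    by (auto simp: op_restrict_def op_scale_def op_comp_def op_of_def)
  then show ?thesis
    unfolding set_eq_iff split_paired_all using char_fun_iff[OF assms] resolvent_adjoint_iff by simp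
qed

end

theorem proposition3p2:
  fixes S :: "('a::complex_hilbert \<times> 'a) set" and \<mu> :: complex
    and Y :: "('a \<times> 'a) set"
  assumes "infinite_dimensional TYPE('a)"
    and "separable_space (euclidean :: 'a topology)"
    and "closed_symmetric_operator S"
    and "Im \<mu> > 0"
  defines "Y \<equiv> cayley (shtraus S \<mu>) \<mu>"
  shows "Y = (S -\<^sub>o \<mu> \<cdot>\<^sub>o Id) \<circ>\<^sub>o (S -\<^sub>o cnj \<mu> \<cdot>\<^sub>o Id)\<inverse> \<circ>\<^sub>o op_of (proj (range_space S (cnj \<mu>))) \<and>
    (\<forall>z. Im z > 0 \<longrightarrow>
        bounded_operator_between (defect_space S \<mu>) (defect_space S (cnj \<mu>)) (char_fun S \<mu> z)
      \<and> bounded_operator_between UNIV UNIV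
          ((Id -\<^sub>o ((z - \<mu>) / (z - cnj \<mu>)) \<cdot>\<^sub>o op_adjoint Y)\<inverse>)
      \<and> char_fun S \<mu> z =
          ((z - \<mu>) / (z - cnj \<mu>)) \<cdot>\<^sub>o
            (op_of (proj (defect_space S (cnj \<mu>)))
              \<circ>\<^sub>o (Id -\<^sub>o ((z - \<mu>) / (z - cnj \<mu>)) \<cdot>\<^sub>o op_adjoint Y)\<inverse>)
          \<restriction>\<^sub>o defect_space S \<mu>) \<and>
    (closure (Domain S) \<noteq> UNIV \<longrightarrow>
      (\<forall>f \<in> dom_defect_proj S \<mu>.
        nontangential_limit_at_infinity (\<lambda>z. op_app (char_fun S \<mu> z) f) (op_app (V_op S \<mu>) f)))"
proof -
  interpret symmetric_cayley S \<mu>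
    by unfold_locales fact+
  have "nontangential_limit_at_infinity (\<lambda>z. op_app (char_fun S \<mu> z) f) (op_app (V_op S \<mu>) f)"
    if "f \<in> dom_defect_proj S \<mu>" for f
    using that nontangential_limit_char_fun by (auto simp: dom_defect_proj_def V_op_app)
  then show ?thesis
    unfolding Y_def
    using cayley_shtraus_self bounded_char_fun bounded_resolvent_adjoint char_fun_eq by blast
qed

end
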